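(* Let $\alpha\in(0,1)$. In the transductive networked-interference model described in the context, let $I\sim\mathrm{Unif}(\{1,\dots,N\})$ be drawn independently of all other variables. Then the prediction set $$\Gamma_I^{\mathrm{IA-WCP}}=\left\{y\in\mathcal Y:\ p_{I,y}^{\mathrm{obs}}>(\alpha-\rho_{I,y})_+\right\}$$ satisfies $$\Pr\left[Y_I(1)\notin\Gamma_I^{\mathrm{IA-WCP}}\ \middle|\ T_I=0\right]\le\alpha .$$
   Context: Model. There are $N$ units $i\in\{1,\dots,N\}$. Unit $i$ has a covariate $X_i\in\mathcal X$, a binary treatment $T_i\in\{0,1\}$, an exposure $E_i\in\mathcal E$, and potential outcomes $Y_i(0),Y_i(1)\in\mathcal Y$. Write $X_{1:N}=(X_1,\dots,X_N)$, $T_{1:N}=(T_1,\dots,T_N)$, $E_{1:N}=(E_1,\dots,E_N)$. The covariates $X_1,\dots,X_N$ are i.i.d. from a distribution $P_X$ on $\mathcal X$. (Treatment assignment and overlap.) There is a function $\pi:\mathcal X\to(0,1)$ such that, conditionally on $X_{1:N}$, the treatments are independent with $T_i\sim\mathrm{Bernoulli}(\pi(X_i))$; moreover there is $\underline\pi\in(0,1/2]$ with $\underline\pi\le\pi(x)\le1-\underline\pi$ for all $x\in\mathcal X$. (Neighborhoods.) Each unit $i$ has a neighborhood $\mathcal N_i(X_{1:N})\subseteq\{1,\dots,N\}\setminus\{i\}$ which is a function of $X_{1:N}$; the relation may be directed. The rule is permutation-equivariant: for every permutation $\sigma$ of $\{1,\dots,N\}$ and every $i$, $\mathcal N_i(X_{\sigma(1)},\dots,X_{\sigma(N)})=\{j:\sigma(j)\in\mathcal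 N_{\sigma(i)}(X_{1:N})\}$. The local configuration of unit $i$ is the multiset $\mathcal L_i(X_{1:N},T_{1:N})=\{\{(X_j,T_j):j\in\mathcal N_i(X_{1:N})\}\}$. (Exposures.) Conditionally on $(X_{1:N},T_{1:N})$ the exposures $E_1,\dots,E_N$ are independent, and there is a common kernel $P_{E\mid X,\mathcal L}$ with $E_i\mid(X_{1:N},T_{1:N})\sim P_{E\mid X,\mathcal L}(\cdot\mid X_i,\mathcal L_i(X_{1:N},T_{1:N}))$ for each $i$. The exposures are observed, or exactly recoverable from $X_i$ and $\mathcal L_i(X_{1:N},T_{1:N})$. (Outcomes.) Conditionally on $(X_{1:N},E_{1:N},T_{1:N})$ the pairs $(Y_i(0),Y_i(1))_{i=1}^N$ are independent across units, and for $t\in\{0,1\}$ there is a common kernel $P_{Y(t)\mid X,E}$ with $Y_i(t)\mid(X_{1:N},E_{1:N},T_{1:N})\sim P_{Y(t)\mid X,E}(\cdot\mid X_i,E_i)$. (Consistency.) The observed outcome is $Y_i^{\mathrm{obs}}=Y_i(T_i)$. Definitions. $\mathcal I_1=\{j:T_j=1\}$. $S:\mathcal X\times\mathcal E\times\mathcal Y\to\mathbb R$ is a fixed (measurable) nonconformity score. $V_j^{\mathrm{obs}}=S(X_j,E_j,Y_j(1))$ for $j\in\mathcal I_1$, and $V_I(y)=S(X_I,E_I,y)$ for $y\in\mathcal Y$. Weights: $W_j=(1-\pi(X_j))/\pi(X_j)$ for $j\in\mathcal I_1\cup\{I\}$. For $T_I=0$, the observational conformal $p$-value is $$p_{I,y}^{\mathrm{obs}}=\frac{W_I+\sum_{j\in\mathcal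 I_1}W_j\mathbf 1\{V_j^{\mathrm{obs}}\ge V_I(y)\}}{W_I+\sum_{j\in\mathcal I_1}W_j}.$$ The affected calibration units are $\mathcal H_I=\{j\in\mathcal I_1:I\in\mathcal N_j(X_{1:N})\}$, and the correction is $$\rho_{I,y}=\frac{\sum_{j\in\mathcal H_I}W_j\mathbf 1\{V_j^{\mathrm{obs}}<V_I(y)\}}{W_I+\sum_{j\in\mathcal I_1}W_j}.$$ Also $(x)_+=\max\{x,0\}$. *)

theory Defs
  imports "HOL-Probability.Probability" "HOL-Combinatorics.Combinatorics"
begin

abbreviation unit_space :: "nat \<Rightarrow> 'a measure \<Rightarrow> (nat \<Rightarrow> 'a) measure" where
  "unit_space N MA \<equiv> PiM {1..N} (\<lambda>_. MA)"

abbreviation unit_vec :: "nat \<Rightarrow> (nat \<Rightarrow> 'w \<Rightarrow> 'a) \<Rightarrow> 'w \<Rightarrow> (nat \<Rightarrow> 'a)" where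
  "unit_vec N Z w \<equiv> (\<lambda>i\<in>{1..N}. Z i w)"

text \<open>
  The usual measurable structure on finite multisets over \<open>MA\<close> (finite point configurations):
  it is generated by the maps counting the points, with multiplicity, that lie in a measurable set.
\<close>

definition multiset_space :: "'a measure \<Rightarrow> 'a multiset measure" where
  "multiset_space MA = sigma {L. set_mset L \<subseteq> space MA}
     {{L. set_mset L \<subseteq> space MA \<and> size {#z \<in># L. z \<in> B#} = k} | B k. B \<in> sets MA}"

definition cond_pr :: "'w measure \<Rightarrow> 'a measure \<Rightarrow> ('w \<Rightarrow> 'a) \<Rightarrow> 'w set \<Rightarrow> 'w \<Rightarrow> real" where
  "cond_pr M MA A B = real_cond_exp M (vimage_algebra (space M) A MA) (indicator B)"

text \<open>
  For a finite index set \<open>J\<close> no quantification over subsets of \<open>J\<close> is needed, since any of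
  the sets \<open>B i\<close> may be the whole space.
\<close>

definition cond_indep_vars ::
  "'w measure \<Rightarrow> 'a measure \<Rightarrow> ('w \<Rightarrow> 'a) \<Rightarrow> 'b measure \<Rightarrow> (nat \<Rightarrow> 'w \<Rightarrow> 'b) \<Rightarrow> nat set \<Rightarrow> bool" where
  "cond_indep_vars M MA A MB Z J \<longleftrightarrow>
     (\<forall>B \<in> J \<rightarrow> sets MB. AE w in M.
        cond_pr M MA A {v \<in> space M. \<forall>i\<in>J. Z i v \<in> B i} w =
        (\<Prod>i\<in>J. cond_pr M MA A {v \<in> space M. Z i v \<in> B i} w))"

text \<open>
  The conditional law of \<open>Z\<close> given \<open>A\<close> is the random measure \<open>K\<close>. In the uses below,
  \<open>K w\<close> is a measurable kernel evaluated at a measurable function of \<open>A w\<close>.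
\<close>

definition cond_law ::
  "'w measure \<Rightarrow> 'a measure \<Rightarrow> ('w \<Rightarrow> 'a) \<Rightarrow> 'b measure \<Rightarrow> ('w \<Rightarrow> 'b) \<Rightarrow> ('w \<Rightarrow> 'b measure) \<Rightarrow> bool" where
  "cond_law M MA A MB Z K \<longleftrightarrow>
     (\<forall>B \<in> sets MB. AE w in M. cond_pr M MA A {v \<in> space M. Z v \<in> B} w = measure (K w) B)"

definition local_config ::
  "(nat \<Rightarrow> (nat \<Rightarrow> 'x) \<Rightarrow> nat set) \<Rightarrow> nat \<Rightarrow> (nat \<Rightarrow> 'x) \<Rightarrow> (nat \<Rightarrow> bool) \<Rightarrow> ('x \<times> bool) multiset" where
  "local_config Nb i x t = {# (x j, t j). j \<in># mset_set (Nb i x) #}"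

text \<open>
  Treatments are Boolean, with \<open>True\<close> for treatment \<open>1\<close> and \<open>False\<close> for treatment \<open>0\<close>;
  \<open>Y i t\<close> is the potential outcome of unit \<open>i\<close> under treatment \<open>t\<close>. The sets of possible
  covariates, exposures and outcomes are the spaces of \<open>MX\<close>, \<open>ME\<close> and \<open>MY\<close>.
  The neighborhood rule \<open>Nb\<close> is applied to covariate vectors in \<open>space (unit_space N MX)\<close>,
  which are extensional functions on \<open>{1..N}\<close>.
\<close>

locale networked_interference = prob_space M
  for M :: "'w measure" +
  fixes MX :: "'x measure" and ME :: "'e measure" and MY :: "'y measure"
    and N :: nat
    and PX :: "'x measure"
    and \<pi> :: "'x \<Rightarrow> real"
    and Nb :: "nat \<Rightarrow> (nat \<Rightarrow> 'x) \<Rightarrow> nat set"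
    and PE :: "'x \<times> ('x \<times> bool) multiset \<Rightarrow> 'e measure"
    and PY :: "bool \<Rightarrow> 'x \<times> 'e \<Rightarrow> 'y measure"
    and X :: "nat \<Rightarrow> 'w \<Rightarrow> 'x"
    and T :: "nat \<Rightarrow> 'w \<Rightarrow> bool"
    and E :: "nat \<Rightarrow> 'w \<Rightarrow> 'e"
    and Y :: "nat \<Rightarrow> bool \<Rightarrow> 'w \<Rightarrow> 'y"
    and Yobs :: "nat \<Rightarrow> 'w \<Rightarrow> 'y"
  assumes N_pos: "N \<ge> 1"
    and X_measurable: "\<And>i. i \<in> {1..N} \<Longrightarrow> X i \<in> M \<rightarrow>\<^sub>M MX"
    and T_measurable: "\<And>i. i \<in> {1..N} \<Longrightarrow> T i \<in> M \<rightarrow>\<^sub>M count_space UNIV"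
    and E_measurable: "\<And>i. i \<in> {1..N} \<Longrightarrow> E i \<in> M \<rightarrow>\<^sub>M ME"
    and Y_measurable: "\<And>i t. i \<in> {1..N} \<Longrightarrow> Y i t \<in> M \<rightarrow>\<^sub>M MY"
    \<comment> \<open>covariates\<close>
    and PX_prob: "PX \<in> space (prob_algebra MX)"
    and X_indep: "indep_vars (\<lambda>_. MX) X {1..N}"
    and X_distr: "\<And>i. i \<in> {1..N} \<Longrightarrow> distr M MX (X i) = PX"
    \<comment> \<open>treatment assignment and overlap\<close>
    and \<pi>_measurable: "\<pi> \<in> borel_measurable MX"
    and \<pi>_range: "\<And>x. x \<in> space MX \<Longrightarrow> 0 < \<pi> x \<and> \<pi> x < 1"
    and overlap: "\<exists>c::real. 0 < c \<and> c \<le> 1/2 \<and> (\<forall>x\<in>space MX. c \<le> \<pi> x \<and> \<pi> x \<le> 1 - c)"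
    and T_indep: "cond_indep_vars M (unit_space N MX) (unit_vec N X) (count_space UNIV) T {1..N}"
    and T_law: "\<And>i. i \<in> {1..N} \<Longrightarrow>
      cond_law M (unit_space N MX) (unit_vec N X) (count_space UNIV) (T i)
        (\<lambda>w. measure_pmf (bernoulli_pmf (\<pi> (X i w))))"
    \<comment> \<open>neighborhoods\<close>
    and Nb_subset: "\<And>i x. i \<in> {1..N} \<Longrightarrow> x \<in> space (unit_space N MX) \<Longrightarrow> Nb i x \<subseteq> {1..N} - {i}"
    and Nb_measurable: "\<And>i j. i \<in> {1..N} \<Longrightarrow> j \<in> {1..N} \<Longrightarrow>
      {x \<in> space (unit_space N MX). j \<in> Nb i x} \<in> sets (unit_space N MX)"
    and Nb_equivariant: "\<And>\<sigma> i x. \<sigma> permutes {1..N} \<Longrightarrow> i \<in> {1..N} \<Longrightarrow>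
      x \<in> space (unit_space N MX) \<Longrightarrow>
      Nb i (\<lambda>k\<in>{1..N}. x (\<sigma> k)) = {j \<in> {1..N}. \<sigma> j \<in> Nb (\<sigma> i) x}"
    \<comment> \<open>exposures\<close>
    and PE_kernel: "PE \<in> MX \<Otimes>\<^sub>M multiset_space (MX \<Otimes>\<^sub>M count_space UNIV) \<rightarrow>\<^sub>M prob_algebra ME"
    and E_indep: "cond_indep_vars M
      (unit_space N MX \<Otimes>\<^sub>M unit_space N (count_space UNIV))
      (\<lambda>w. (unit_vec N X w, unit_vec N T w)) ME E {1..N}"
    and E_law: "\<And>i. i \<in> {1..N} \<Longrightarrow> cond_law M
      (unit_space N MX \<Otimes>\<^sub>M unit_space N (count_space UNIV))
      (\<lambda>w. (unit_vec N X w, unit_vec N T w)) ME (E i)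
      (\<lambda>w. PE (X i w, local_config Nb i (unit_vec N X w) (unit_vec N T w)))"
    \<comment> \<open>outcomes\<close>
    and PY_kernel: "\<And>t. PY t \<in> MX \<Otimes>\<^sub>M ME \<rightarrow>\<^sub>M prob_algebra MY"
    and Y_indep: "cond_indep_vars M
      (unit_space N MX \<Otimes>\<^sub>M unit_space N ME \<Otimes>\<^sub>M unit_space N (count_space UNIV))
      (\<lambda>w. (unit_vec N X w, unit_vec N E w, unit_vec N T w))
      (MY \<Otimes>\<^sub>M MY) (\<lambda>i w. (Y i False w, Y i True w)) {1..N}"
    and Y_law: "\<And>i t. i \<in> {1..N} \<Longrightarrow> cond_law M
      (unit_space N MX \<Otimes>\<^sub>M unit_space N ME \<Otimes>\<^sub>M unit_space N (count_space UNIV))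
      (\<lambda>w. (unit_vec N X w, unit_vec N E w, unit_vec N T w)) MY (Y i t)
      (\<lambda>w. PY t (X i w, E i w))"
    \<comment> \<open>consistency\<close>
    and consistency: "\<And>i w. i \<in> {1..N} \<Longrightarrow> w \<in> space M \<Longrightarrow> Yobs i w = Y i (T i w) w"

text \<open>
  The following are deterministic functions of realized vectors \<open>x\<close>, \<open>t\<close>, \<open>e\<close> of covariates,
  treatments and exposures, the realized vector \<open>y1\<close> of outcomes under treatment \<open>1\<close> (of which
  only the entries of treated units are used), the realized test unit \<open>i\<close> and a candidate
  outcome \<open>y\<close>.
\<close>

definition treated :: "nat \<Rightarrow> (nat \<Rightarrow> bool) \<Rightarrow> nat set" where
  "treated N t = {j \<in> {1..N}. t j}"

definition wt :: "('x \<Rightarrow> real) \<Rightarrow> 'x \<Rightarrow> real" where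
  "wt \<pi> x = (1 - \<pi> x) / \<pi> x"

definition p_obs ::
  "nat \<Rightarrow> ('x \<Rightarrow> real) \<Rightarrow> ('x \<times> 'e \<times> 'y \<Rightarrow> real) \<Rightarrow>
   (nat \<Rightarrow> 'x) \<Rightarrow> (nat \<Rightarrow> bool) \<Rightarrow> (nat \<Rightarrow> 'e) \<Rightarrow> (nat \<Rightarrow> 'y) \<Rightarrow> nat \<Rightarrow> 'y \<Rightarrow> real" where
  "p_obs N \<pi> S x t e y1 i y =
     (wt \<pi> (x i) + (\<Sum>j\<in>treated N t. wt \<pi> (x j) * of_bool (S (x j, e j, y1 j) \<ge> S (x i, e i, y)))) /
     (wt \<pi> (x i) + (\<Sum>j\<in>treated N t. wt \<pi> (x j)))"

definition affected ::
  "nat \<Rightarrow> (nat \<Rightarrow> (nat \<Rightarrow> 'x) \<Rightarrow> nat set) \<Rightarrow> (nat \<Rightarrow> 'x) \<Rightarrow> (nat \<Rightarrow> bool) \<Rightarrow> nat \<Rightarrow> nat set" where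
  "affected N Nb x t i = {j \<in> treated N t. i \<in> Nb j x}"

definition correction ::
  "nat \<Rightarrow> ('x \<Rightarrow> real) \<Rightarrow> (nat \<Rightarrow> (nat \<Rightarrow> 'x) \<Rightarrow> nat set) \<Rightarrow> ('x \<times> 'e \<times> 'y \<Rightarrow> real) \<Rightarrow>
   (nat \<Rightarrow> 'x) \<Rightarrow> (nat \<Rightarrow> bool) \<Rightarrow> (nat \<Rightarrow> 'e) \<Rightarrow> (nat \<Rightarrow> 'y) \<Rightarrow> nat \<Rightarrow> 'y \<Rightarrow> real" where
  "correction N \<pi> Nb S x t e y1 i y =
     (\<Sum>j\<in>affected N Nb x t i. wt \<pi> (x j) * of_bool (S (x j, e j, y1 j) < S (x i, e i, y))) /
     (wt \<pi> (x i) + (\<Sum>j\<in>treated N t. wt \<pi> (x j)))"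

definition ia_wcp_set ::
  "nat \<Rightarrow> 'y measure \<Rightarrow> ('x \<Rightarrow> real) \<Rightarrow> (nat \<Rightarrow> (nat \<Rightarrow> 'x) \<Rightarrow> nat set) \<Rightarrow> ('x \<times> 'e \<times> 'y \<Rightarrow> real) \<Rightarrow>
   real \<Rightarrow> (nat \<Rightarrow> 'x) \<Rightarrow> (nat \<Rightarrow> bool) \<Rightarrow> (nat \<Rightarrow> 'e) \<Rightarrow> (nat \<Rightarrow> 'y) \<Rightarrow> nat \<Rightarrow> 'y set" where
  "ia_wcp_set N MY \<pi> Nb S \<alpha> x t e y1 i =
     {y \<in> space MY. p_obs N \<pi> S x t e y1 i y > max (\<alpha> - correction N \<pi> Nb S x t e y1 i y) 0}"

end

theory Submission
  imports Defs
begin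

text \<open>
  Fix a unit \<open>i\<close> and compare a treatment vector \<open>t\<close> with \<open>t i = False\<close> to \<open>t' = t(i := True)\<close>.
  Conditionally on the covariates, \<open>t\<close> is \<open>wt \<pi> (x i)\<close> times as likely as \<open>t'\<close>, and the kernels that
  generate the exposure and outcome of \<open>j\<close> are the same under both unless \<open>i\<close> is a neighbor of \<open>j\<close>.
  The sum of \<open>p_obs\<close> and \<open>correction\<close> is what \<open>p_obs\<close> becomes when every affected unit is counted as
  exceeding the score of \<open>i\<close>; it therefore depends only on units whose law is unchanged, so the probability
  of a miss at \<open>i\<close> can be computed under \<open>t'\<close> with the extra factor \<open>wt \<pi> (x i)\<close>. Under \<open>t'\<close> the unit
  \<open>i\<close> is itself treated, a miss forces its score into the upper \<open>\<alpha>\<close>-tail of the weighted scores of the treated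
  units, and the treated units in that tail carry at most a fraction \<open>\<alpha>\<close> of the total weight. Summing over
  \<open>i\<close> and flipping back gives the bound.
\<close>

section \<open>Conditional laws under a change of density\<close>

text \<open>The defining property of conditional expectation, for the sigma-algebra generated by
  \<open>A\<close>. Boundedness of \<open>h\<close> supplies the integrability it asks for.\<close>

lemma (in prob_space) cond_pr_integral:
  assumes A: "A \<in> M \<rightarrow>\<^sub>M MA" and B: "B \<in> events"
    and h: "h \<in> borel_measurable MA" "\<And>a. a \<in> space MA \<Longrightarrow> \<bar>h a\<bar> \<le> c"
  shows "(\<integral>w. h (A w) * indicator B w \<partial>M) = (\<integral>w. h (A w) * cond_pr M MA A B w \<partial>M)"
proof -
  define F where "F = vimage_algebra (space M) A MA"
  have "subalgebra M F"
    unfolding subalgebra_def F_def using A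
    by (auto simp: sets_vimage_algebra2[OF measurable_space[OF A, THEN funcsetI]] measurable_sets)
  then interpret F: finite_measure_subalgebra M F
    by unfold_locales
  have AF: "A \<in> F \<rightarrow>\<^sub>M MA"
    unfolding F_def by (rule measurable_vimage_algebra1) (use A in \<open>auto dest: measurable_space\<close>)
  have hF: "(\<lambda>w. h (A w)) \<in> borel_measurable F"
    using AF h(1) by (rule measurable_compose)
  have hM: "(\<lambda>w. h (A w)) \<in> borel_measurable M"
    using A h(1) by (rule measurable_compose)
  have "integrable M (\<lambda>w. h (A w) * indicator B w)"
  proof (rule integrable_const_bound[of _ "\<bar>c\<bar>"])
    show "AE w in M. norm (h (A w) * indicator B w) \<le> \<bar>c\<bar>"
      using h(2) A by (intro AE_I2) (auto simp: indicator_def dest!: measurable_space intro: order_trans[OF _ abs_ge_self])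
  qed (use hM B in measurable)
  then show ?thesis
    using F.real_cond_exp_intg(2)[OF _ hF, of "indicator B"] B by (simp add: cond_pr_def F_def)
qed

text \<open>Conditional independence turns the conditional probability of the box into a product,
  and the conditional laws identify its factors. Agreement with the functions \<open>k j\<close> of
  \<open>A\<close> is required only where \<open>h (A w)\<close> is nonzero, since elsewhere both
  integrands vanish; this is what later lets a random treatment vector be replaced by a fixed one
  inside a kernel.\<close>

lemma (in prob_space) cond_law_rectangle:
  assumes A: "A \<in> M \<rightarrow>\<^sub>M MA"
    and Z: "\<And>i. i \<in> I \<Longrightarrow> Z i \<in> M \<rightarrow>\<^sub>M MB"
    and "finite I" "J \<subseteq> I"
    and indep: "cond_indep_vars M MA A MB Z I"
    and law: "\<And>j. j \<in> J \<Longrightarrow> cond_law M MA A MB (Z j) (K j)"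
    and B: "\<And>j. j \<in> J \<Longrightarrow> B j \<in> sets MB"
    and h: "h \<in> borel_measurable MA" "\<And>a. a \<in> space MA \<Longrightarrow> \<bar>h a\<bar> \<le> c"
    and k: "\<And>j. j \<in> J \<Longrightarrow> k j \<in> borel_measurable MA"
    and Kk: "\<And>w j. w \<in> space M \<Longrightarrow> j \<in> J \<Longrightarrow> h (A w) \<noteq> 0 \<Longrightarrow> measure (K j w) (B j) = k j (A w)"
  shows "(\<integral>w. h (A w) * indicator {w\<in>space M. \<forall>j\<in>J. Z j w \<in> B j} w \<partial>M) =
    (\<integral>w. h (A w) * (\<Prod>j\<in>J. k j (A w)) \<partial>M)"
proof -
  \<comment> \<open>Conditional independence speaks about boxes over all of \<open>I\<close>.
    Coordinates outside \<open>J\<close> are padded by the whole space, and their factors have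
    conditional probability 1 almost everywhere.\<close>
  define B' where "B' i = (if i \<in> J then B i else space MB)" for i
  have B': "B' i \<in> sets MB" for i
    using B by (simp add: B'_def)
  have eq: "{w\<in>space M. \<forall>j\<in>J. Z j w \<in> B j} = {w\<in>space M. \<forall>i\<in>I. Z i w \<in> B' i}"
    using \<open>J \<subseteq> I\<close> measurable_space[OF Z] by (fastforce simp: B'_def)
  have ev: "{w\<in>space M. \<forall>i\<in>I. Z i w \<in> B' i} \<in> events"
    using \<open>finite I\<close> Z B' by (intro sets.sets_Collect_finite_All' sets.sets_Collect_finite_All) (auto simp: measurable_sets_Collect)
  have 1: "AE w in M. cond_pr M MA A {v \<in> space M. \<forall>i\<in>I. Z i v \<in> B' i} w =
        (\<Prod>i\<in>I. cond_pr M MA A {v \<in> space M. Z i v \<in> B' i} w)"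
    using indep B' by (auto simp: cond_indep_vars_def)
  have sub: "subalgebra M (vimage_algebra (space M) A MA)"
    unfolding subalgebra_def using A
    by (auto simp: sets_vimage_algebra2[OF measurable_space[OF A, THEN funcsetI]] measurable_sets)
  then interpret F: finite_measure_subalgebra M "vimage_algebra (space M) A MA"
    by unfold_locales
  have "AE w in M. real_cond_exp M (vimage_algebra (space M) A MA) (\<lambda>_. 1) w = 1"
    by (rule F.real_cond_exp_F_meas) auto
  moreover have "AE w in M. real_cond_exp M (vimage_algebra (space M) A MA) (indicator (space M)) w =
      real_cond_exp M (vimage_algebra (space M) A MA) (\<lambda>_. 1) w"
    by (rule F.real_cond_exp_cong) auto
  ultimately have "AE w in M. cond_pr M MA A (space M) w = 1"
    unfolding cond_pr_def by eventually_elim simp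
  moreover have "{v \<in> space M. Z i v \<in> B' i} = space M" if "i \<in> I - J" for i
    using that measurable_space[OF Z] by (auto simp: B'_def)
  ultimately have 2: "AE w in M. \<forall>i\<in>I-J. cond_pr M MA A {v \<in> space M. Z i v \<in> B' i} w = 1"
    using \<open>finite I\<close> by (intro AE_finite_allI) auto
  have 3: "AE w in M. \<forall>i\<in>J. cond_pr M MA A {v \<in> space M. Z i v \<in> B' i} w = measure (K i w) (B i)"
    using \<open>finite I\<close> \<open>J \<subseteq> I\<close> law B
    by (intro AE_finite_allI) (auto simp: cond_law_def B'_def intro: finite_subset)
  have 4: "AE w in M. h (A w) * cond_pr M MA A {v \<in> space M. \<forall>i\<in>I. Z i v \<in> B' i} w =
     h (A w) * (\<Prod>j\<in>J. k j (A w))"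
    using 1 2 3 AE_space
  proof (eventually_elim, goal_cases)
    case (1 w)
    have "h (A w) * (\<Prod>i\<in>I. cond_pr M MA A {v \<in> space M. Z i v \<in> B' i} w) =
       h (A w) * (\<Prod>j\<in>J. cond_pr M MA A {v \<in> space M. Z j v \<in> B' j} w)"
      using 1 \<open>finite I\<close> \<open>J \<subseteq> I\<close> by (subst prod.mono_neutral_right[of I J]) auto
    also have "\<dots> = h (A w) * (\<Prod>j\<in>J. measure (K j w) (B j))"
      using 1 by simp
    finally show ?case
      using 1 Kk by (cases "h (A w) = 0"; simp)
  qed
  have "(\<integral>w. h (A w) * indicator {w\<in>space M. \<forall>j\<in>J. Z j w \<in> B j} w \<partial>M) =
     (\<integral>w. h (A w) * cond_pr M MA A {v \<in> space M. \<forall>i\<in>I. Z i v \<in> B' i} w \<partial>M)"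
    unfolding eq by (rule cond_pr_integral[OF A ev h])
  also have "\<dots> = (\<integral>w. h (A w) * (\<Prod>j\<in>J. k j (A w)) \<partial>M)"
  proof (rule integral_cong_AE[OF _ _ 4])
    have [measurable]: "cond_pr M MA A B \<in> borel_measurable M" for B
      unfolding cond_pr_def by (rule borel_measurable_cond_exp2)
    note [measurable] = A h(1) k
    show "(\<lambda>w. h (A w) * cond_pr M MA A {v \<in> space M. \<forall>i\<in>I. Z i v \<in> B' i} w) \<in> borel_measurable M"
      by measurable
    show "(\<lambda>w. h (A w) * (\<Prod>j\<in>J. k j (A w))) \<in> borel_measurable M"
      by measurable
  qed
  finally show ?thesis .
qed

section \<open>Weighted image measures and their transfer along a kernel\<close>

text \<open>Usually not a probability measure: \<open>u\<close> will be the indicator of an event,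
  possibly times a weight. Equality of two such measures says in one equation that the two densities
  cannot be told apart by functions of \<open>A\<close>.\<close>

definition tilted_law :: "'w measure \<Rightarrow> ('w \<Rightarrow> real) \<Rightarrow> 'a measure \<Rightarrow> ('w \<Rightarrow> 'a) \<Rightarrow> 'a measure" where
  "tilted_law M u MA A = distr (density M (\<lambda>w. ennreal (u w))) MA A"

lemma sets_tilted_law [simp]: "sets (tilted_law M u MA A) = sets MA"
  and space_tilted_law [simp]: "space (tilted_law M u MA A) = space MA"
  by (simp_all add: tilted_law_def)

lemma integral_tilted_law:
  fixes h :: "_ \<Rightarrow> real"
  assumes "A \<in> M \<rightarrow>\<^sub>M MA" "u \<in> borel_measurable M" "\<And>w. w \<in> space M \<Longrightarrow> 0 \<le> u w"
    "h \<in> borel_measurable MA"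
  shows "(\<integral>a. h a \<partial>tilted_law M u MA A) = (\<integral>w. u w * h (A w) \<partial>M)"
  using assms unfolding tilted_law_def
  by (subst integral_distr) (auto simp: integral_density AE_I2)

lemma (in prob_space) emeasure_tilted_law:
  assumes A: "A \<in> M \<rightarrow>\<^sub>M MA" and u: "u \<in> borel_measurable M"
    "\<And>w. w \<in> space M \<Longrightarrow> 0 \<le> u w" "\<And>w. w \<in> space M \<Longrightarrow> u w \<le> c" and C: "C \<in> sets MA"
  shows "emeasure (tilted_law M u MA A) C = ennreal (\<integral>w. u w * indicator C (A w) \<partial>M)"
proof -
  have "emeasure (tilted_law M u MA A) C = (\<integral>\<^sup>+w. ennreal (u w) * indicator (A -` C \<inter> space M) w \<partial>M)"
    using A u C by (simp add: tilted_law_def emeasure_distr emeasure_density measurable_sets)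
  also have "\<dots> = (\<integral>\<^sup>+w. ennreal (u w * indicator C (A w)) \<partial>M)"
    by (intro nn_integral_cong) (simp split: split_indicator)
  also have "\<dots> = ennreal (\<integral>w. u w * indicator C (A w) \<partial>M)"
  proof (rule nn_integral_eq_integral)
    show "integrable M (\<lambda>w. u w * indicator C (A w))"
    proof (rule integrable_const_bound[of _ "\<bar>c\<bar>"])
      show "AE w in M. norm (u w * indicator C (A w)) \<le> \<bar>c\<bar>"
        using u by (intro AE_I2) (auto simp: indicator_def intro: order_trans[OF _ abs_ge_self])
    qed (use A u(1) C in measurable)
    show "AE w in M. 0 \<le> u w * indicator C (A w)"
      using u by (intro AE_I2) (auto simp: indicator_def)
  qed
  finally show ?thesis .
qed

text \<open>Supplies the rectangles for the uniqueness argument in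
  \<open>tilted_law_transfer\<close>, where the data already compared and finitely many new
  coordinates sit in one product space.\<close>

lemma sets_pair_PiM_generator:
  assumes "finite J"
  shows "sets (MA \<Otimes>\<^sub>M PiM J (\<lambda>_. MB)) =
    sigma_sets (space (MA \<Otimes>\<^sub>M PiM J (\<lambda>_. MB))) {C \<times> PiE J B | C B. C \<in> sets MA \<and> (\<forall>j\<in>J. B j \<in> sets MB)}"
    (is "_ = sigma_sets _ ?E")
proof -
  have P: "prod_algebra J (\<lambda>_. MB) = {PiE J B | B. \<forall>j\<in>J. B j \<in> sets MB}"
    by (auto simp: prod_algebra_eq_finite[OF assms])
  have E: "?E = {a \<times> b |a b. a \<in> sets MA \<and> b \<in> prod_algebra J (\<lambda>_. MB)}"
    unfolding P by auto
  have "sets (MA \<Otimes>\<^sub>M PiM J (\<lambda>_. MB)) = sets (sigma (space MA \<times> space (PiM J (\<lambda>_. MB))) ?E)"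
    unfolding E
  proof (rule sets_pair_eq)
    show "{space MA} \<subseteq> sets MA" "sets MA \<subseteq> Pow (space MA)" "sets MA = sigma_sets (space MA) (sets MA)"
      using sets.space_closed by (auto simp: sets.sigma_sets_eq)
    show "prod_algebra J (\<lambda>_. MB) \<subseteq> Pow (space (Pi\<^sub>M J (\<lambda>_. MB)))"
      using prod_algebra_sets_into_space[of J "\<lambda>_. MB"] by (simp add: space_PiM)
    show "sets (Pi\<^sub>M J (\<lambda>_. MB)) = sigma_sets (space (Pi\<^sub>M J (\<lambda>_. MB))) (prod_algebra J (\<lambda>_. MB))"
      by (simp add: sets_PiM space_PiM)
    show "{space (Pi\<^sub>M J (\<lambda>_. MB))} \<subseteq> prod_algebra J (\<lambda>_. MB)"
      by (auto simp: P space_PiM)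
  qed auto
  moreover have "?E \<subseteq> Pow (space MA \<times> space (PiM J (\<lambda>_. MB)))"
  proof
    fix D assume "D \<in> ?E"
    then obtain C B where D: "D = C \<times> PiE J B" "C \<in> sets MA" "\<And>j. j \<in> J \<Longrightarrow> B j \<in> sets MB"
      by auto
    show "D \<in> Pow (space MA \<times> space (PiM J (\<lambda>_. MB)))"
      unfolding D(1) space_PiM by (intro PowI Sigma_mono PiE_mono sets.sets_into_space D)
  qed
  ultimately show ?thesis
    by (simp add: space_pair_measure)
qed

text \<open>
  The densities may depend on parts of \<open>A\<close> that \<open>g\<close> forgets, such as the treatment vector; the kernels
  may not, but only where one of the densities is nonzero.
\<close>

lemma (in prob_space) tilted_law_transfer:
  assumes A: "A \<in> M \<rightarrow>\<^sub>M MA"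
    and Z: "\<And>i. i \<in> I \<Longrightarrow> Z i \<in> M \<rightarrow>\<^sub>M MB"
    and I: "finite I" "J \<subseteq> I"
    and indep: "cond_indep_vars M MA A MB Z I"
    and law: "\<And>j. j \<in> J \<Longrightarrow> cond_law M MA A MB (Z j) (K j)"
    and g: "g \<in> MA \<rightarrow>\<^sub>M MG"
    and \<kappa>: "\<And>j. j \<in> J \<Longrightarrow> \<kappa> j \<in> MG \<rightarrow>\<^sub>M prob_algebra MB"
    and u: "u \<in> borel_measurable MA" "\<And>a. a \<in> space MA \<Longrightarrow> 0 \<le> u a" "\<And>a. a \<in> space MA \<Longrightarrow> u a \<le> c"
    and v: "v \<in> borel_measurable MA" "\<And>a. a \<in> space MA \<Longrightarrow> 0 \<le> v a" "\<And>a. a \<in> space MA \<Longrightarrow> v a \<le> c"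
    and K: "\<And>j w. j \<in> J \<Longrightarrow> w \<in> space M \<Longrightarrow> u (A w) \<noteq> 0 \<or> v (A w) \<noteq> 0 \<Longrightarrow> K j w = \<kappa> j (g (A w))"
    and eq: "tilted_law M (\<lambda>w. u (A w)) MG (\<lambda>w. g (A w)) = tilted_law M (\<lambda>w. v (A w)) MG (\<lambda>w. g (A w))"
  shows "tilted_law M (\<lambda>w. u (A w)) (MG \<Otimes>\<^sub>M PiM J (\<lambda>_. MB)) (\<lambda>w. (g (A w), \<lambda>j\<in>J. Z j w)) =
    tilted_law M (\<lambda>w. v (A w)) (MG \<Otimes>\<^sub>M PiM J (\<lambda>_. MB)) (\<lambda>w. (g (A w), \<lambda>j\<in>J. Z j w))"
proof -
  let ?S = "MG \<Otimes>\<^sub>M PiM J (\<lambda>_. MB)"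
  let ?E = "{C \<times> PiE J B | C B. C \<in> sets MG \<and> (\<forall>j\<in>J. B j \<in> sets MB)}"
  have J: "finite J"
    using I by (rule rev_finite_subset)
  have GA: "(\<lambda>w. g (A w)) \<in> M \<rightarrow>\<^sub>M MG"
    using A g by (rule measurable_compose)
  have ZJ: "(\<lambda>w. \<lambda>j\<in>J. Z j w) \<in> M \<rightarrow>\<^sub>M PiM J (\<lambda>_. MB)"
    using Z I by (intro measurable_restrict) auto
  have f: "(\<lambda>w. (g (A w), \<lambda>j\<in>J. Z j w)) \<in> M \<rightarrow>\<^sub>M ?S"
    using GA ZJ by (rule measurable_Pair)
  define k where "k B x = (\<Prod>j\<in>J. measure (\<kappa> j x) (B j))" for B x
  have km: "(\<lambda>x. measure (\<kappa> j x) (B j)) \<in> borel_measurable MG" if "j \<in> J" "B j \<in> sets MB" for B j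
    using measurable_compose[OF measurable_prob_algebraD[OF \<kappa>[OF that(1)]] measurable_measure_subprob_algebra[OF that(2)]] .
  \<comment> \<open>Where \<open>r (A w)\<close> is nonzero the kernels see only
    \<open>g (A w)\<close>, so the mass of a rectangle under the density \<open>r\<close> is an
    integral against the tilted law of \<open>g\<close> alone. For \<open>r = u\<close> and
    \<open>r = v\<close> these laws coincide by \<open>eq\<close>.\<close>
  have rect: "(\<integral>w. r (A w) * indicator (C \<times> PiE J B) (g (A w), \<lambda>j\<in>J. Z j w) \<partial>M) =
      (\<integral>x. indicator C x * k B x \<partial>tilted_law M (\<lambda>w. r (A w)) MG (\<lambda>w. g (A w)))"
    if r: "r \<in> borel_measurable MA" "\<And>a. a \<in> space MA \<Longrightarrow> 0 \<le> r a" "\<And>a. a \<in> space MA \<Longrightarrow> r a \<le> c"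
      and rK: "\<And>j w. j \<in> J \<Longrightarrow> w \<in> space M \<Longrightarrow> r (A w) \<noteq> 0 \<Longrightarrow> K j w = \<kappa> j (g (A w))"
      and C: "C \<in> sets MG" and B: "\<forall>j\<in>J. B j \<in> sets MB" for r C B
  proof -
    have h: "(\<lambda>a. r a * indicator C (g a)) \<in> borel_measurable MA"
      using r(1) g C by measurable
    have "(\<integral>w. r (A w) * indicator (C \<times> PiE J B) (g (A w), \<lambda>j\<in>J. Z j w) \<partial>M) =
      (\<integral>w. (r (A w) * indicator C (g (A w))) * indicator {w\<in>space M. \<forall>j\<in>J. Z j w \<in> B j} w \<partial>M)"
      by (intro Bochner_Integration.integral_cong) (auto simp: indicator_def PiE_def Pi_def)
    also have "\<dots> = (\<integral>w. (r (A w) * indicator C (g (A w))) * (\<Prod>j\<in>J. measure (\<kappa> j (g (A w))) (B j)) \<partial>M)"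
    proof (rule cond_law_rectangle[OF A Z I indep law, where h = "\<lambda>a. r a * indicator C (g a)" and c = "\<bar>c\<bar>"
          and k = "\<lambda>j a. measure (\<kappa> j (g a)) (B j)"])
      show "\<bar>r a * indicator C (g a)\<bar> \<le> \<bar>c\<bar>" if "a \<in> space MA" for a
        using r(2,3)[OF that] by (auto simp: indicator_def)
      show "(\<lambda>a. measure (\<kappa> j (g a)) (B j)) \<in> borel_measurable MA" if "j \<in> J" for j
        using km[OF that] B that g by (auto intro: measurable_compose)
    qed (use B h rK in auto)
    also have "\<dots> = (\<integral>w. r (A w) * (indicator C (g (A w)) * k B (g (A w))) \<partial>M)"
      by (simp add: k_def mult.assoc)
    also have "\<dots> = (\<integral>x. indicator C x * k B x \<partial>tilted_law M (\<lambda>w. r (A w)) MG (\<lambda>w. g (A w)))"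
    proof (rule integral_tilted_law[OF GA, symmetric])
      show "(\<lambda>w. r (A w)) \<in> borel_measurable M"
        using A r(1) by (rule measurable_compose)
      show "(\<lambda>x. indicator C x * k B x) \<in> borel_measurable MG"
        unfolding k_def using km B C by (intro borel_measurable_times borel_measurable_prod) auto
    qed (use A r in \<open>auto dest: measurable_space\<close>)
    finally show ?thesis .
  qed
  have em: "emeasure (tilted_law M (\<lambda>w. r (A w)) ?S (\<lambda>w. (g (A w), \<lambda>j\<in>J. Z j w))) D =
      ennreal (\<integral>w. r (A w) * indicator D (g (A w), \<lambda>j\<in>J. Z j w) \<partial>M)"
    if "r \<in> borel_measurable MA" "\<And>a. a \<in> space MA \<Longrightarrow> 0 \<le> r a" "\<And>a. a \<in> space MA \<Longrightarrow> r a \<le> c"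
      and "D \<in> sets ?S" for r D
    using that A by (intro emeasure_tilted_law[OF f, where c = c]) (auto dest: measurable_space)
  have E_sub: "?E \<subseteq> sets ?S"
    using J by (auto intro!: pair_measureI sets_PiM_I_finite)
  show ?thesis
  \<comment> \<open>The densities are bounded, hence both measures are finite and the whole space
    alone serves as the countable cover.\<close>
  proof (rule measure_eqI_generator_eq_countable[where E = ?E and A = "{space ?S}" and \<Omega> = "space ?S"])
    show "Int_stable ?E"
    proof (rule Int_stableI, clarsimp)
      fix C C' B B' assume "C \<in> sets MG" "C' \<in> sets MG" "\<forall>j\<in>J. B j \<in> sets MB" "\<forall>j\<in>J. B' j \<in> sets MB"
      then show "\<exists>D G. (C \<times> PiE J B) \<inter> (C' \<times> PiE J B') = D \<times> PiE J G \<and> D \<in> sets MG \<and> (\<forall>j\<in>J. G j \<in> sets MB)"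
        by (intro exI[of _ "C \<inter> C'"] exI[of _ "\<lambda>j. B j \<inter> B' j"]) (auto simp: PiE_Int Times_Int_Times)
    qed
    show "?E \<subseteq> Pow (space ?S)"
      using E_sub sets.space_closed by blast
    show "emeasure (tilted_law M (\<lambda>w. u (A w)) ?S (\<lambda>w. (g (A w), \<lambda>j\<in>J. Z j w))) D =
      emeasure (tilted_law M (\<lambda>w. v (A w)) ?S (\<lambda>w. (g (A w), \<lambda>j\<in>J. Z j w))) D" if "D \<in> ?E" for D
    proof -
      from that obtain C B where D: "D = C \<times> PiE J B" "C \<in> sets MG" "\<forall>j\<in>J. B j \<in> sets MB"
        by auto
      have "D \<in> sets ?S"
        using that E_sub by auto
      with em[OF u] em[OF v] show ?thesis
        using rect[OF u _ D(2,3)] rect[OF v _ D(2,3)] K eq by (simp add: D(1))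
    qed
    show "sets (tilted_law M (\<lambda>w. u (A w)) ?S (\<lambda>w. (g (A w), \<lambda>j\<in>J. Z j w))) = sigma_sets (space ?S) ?E"
      "sets (tilted_law M (\<lambda>w. v (A w)) ?S (\<lambda>w. (g (A w), \<lambda>j\<in>J. Z j w))) = sigma_sets (space ?S) ?E"
      using sets_pair_PiM_generator[OF J, of MG MB] by simp_all
    show "{space ?S} \<subseteq> ?E"
      by (auto simp: space_pair_measure space_PiM)
    show "emeasure (tilted_law M (\<lambda>w. u (A w)) ?S (\<lambda>w. (g (A w), \<lambda>j\<in>J. Z j w))) a \<noteq> \<infinity>" if "a \<in> {space ?S}" for a
      using that em[OF u, of "space ?S"] by auto
  qed auto
qed

section \<open>Flipping the treatment of one unit\<close>

text \<open>The sigma-algebra on multisets is generated by counts, and the number of neighbors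
  falling in \<open>B\<close> is a sum of indicators over the fixed index set \<open>{1..N}\<close>.
  The treatments are a constant \<open>t\<close>, because each density used below is supported on a
  single treatment vector.\<close>

lemma local_config_measurable:
  assumes sub: "\<And>x. x \<in> space (unit_space N MX) \<Longrightarrow> Nb i x \<subseteq> {1..N}"
    and Nb: "\<And>j. j \<in> {1..N} \<Longrightarrow> {x \<in> space (unit_space N MX). j \<in> Nb i x} \<in> sets (unit_space N MX)"
  shows "(\<lambda>x. local_config Nb i x t) \<in> unit_space N MX \<rightarrow>\<^sub>M multiset_space (MX \<Otimes>\<^sub>M count_space UNIV)"
  unfolding multiset_space_def
proof (rule measurable_measure_of)
  let ?X = "unit_space N MX" and ?Z = "MX \<Otimes>\<^sub>M count_space (UNIV :: bool set)"
  have fin: "finite (Nb i x)" if "x \<in> space ?X" for x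
    using sub[OF that] by (rule finite_subset) simp
  show into: "(\<lambda>x. local_config Nb i x t) \<in> space ?X \<rightarrow> {L. set_mset L \<subseteq> space ?Z}"
    using sub fin by (fastforce simp: local_config_def space_pair_measure space_PiM PiE_def Pi_def)
  fix D assume "D \<in> {{L. set_mset L \<subseteq> space ?Z \<and> size {#z \<in># L. z \<in> B#} = k} | B k. B \<in> sets ?Z}"
  then obtain B k where D: "D = {L. set_mset L \<subseteq> space ?Z \<and> size {#z \<in># L. z \<in> B#} = k}" and B: "B \<in> sets ?Z"
    by auto
  have size: "real (size {#z \<in># local_config Nb i x t. z \<in> B#}) =
     (\<Sum>j\<in>{1..N}. indicator {x\<in>space ?X. j \<in> Nb i x} x * indicator B (x j, t j))" if x: "x \<in> space ?X" for x
  proof -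
    have "size {#z \<in># local_config Nb i x t. z \<in> B#} = card {j \<in> Nb i x. (x j, t j) \<in> B}"
      using fin[OF x] by (simp add: local_config_def filter_mset_image_mset filter_mset_mset_set)
    also have "{j \<in> Nb i x. (x j, t j) \<in> B} = {j \<in> {1..N}. j \<in> Nb i x \<and> (x j, t j) \<in> B}"
      using sub[OF x] by auto
    also have "real (card \<dots>) = (\<Sum>j\<in>{1..N}. if j \<in> Nb i x \<and> (x j, t j) \<in> B then 1 else 0)"
      by (simp add: sum.If_cases Int_def)
    also have "\<dots> = (\<Sum>j\<in>{1..N}. indicator {x\<in>space ?X. j \<in> Nb i x} x * indicator B (x j, t j))"
      using x by (intro sum.cong) (auto simp: indicator_def)
    finally show ?thesis .
  qed
  have "(\<lambda>x. \<Sum>j\<in>{1..N}. indicator {x\<in>space ?X. j \<in> Nb i x} x * indicator B (x j, t j) :: real) \<in> borel_measurable ?X"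
  proof (intro borel_measurable_sum borel_measurable_times)
    fix j assume "j \<in> {1..N}"
    then show "(\<lambda>x. indicator {x\<in>space ?X. j \<in> Nb i x} x :: real) \<in> borel_measurable ?X"
      using Nb by (intro borel_measurable_indicator) auto
    have "(\<lambda>x. (x j, t j)) \<in> ?X \<rightarrow>\<^sub>M ?Z"
      using \<open>j \<in> {1..N}\<close> by measurable
    then show "(\<lambda>x. indicator B (x j, t j) :: real) \<in> borel_measurable ?X"
      using B by measurable
  qed
  then have "{x \<in> space ?X. (\<Sum>j\<in>{1..N}. indicator {x\<in>space ?X. j \<in> Nb i x} x * indicator B (x j, t j)) = real k} \<in> sets ?X"
    by measurable
  also have "{x \<in> space ?X. (\<Sum>j\<in>{1..N}. indicator {x\<in>space ?X. j \<in> Nb i x} x * indicator B (x j, t j)) = real k} =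
     (\<lambda>x. local_config Nb i x t) -` D \<inter> space ?X"
  proof -
    have "(\<Sum>j\<in>{1..N}. indicator {x\<in>space ?X. j \<in> Nb i x} x * indicator B (x j, t j)) = real k \<longleftrightarrow>
        local_config Nb i x t \<in> D" if "x \<in> space ?X" for x
      unfolding size[OF that, symmetric] D using into that by auto
    then show ?thesis
      by blast
  qed
  finally show "(\<lambda>x. local_config Nb i x t) -` D \<inter> space ?X \<in> sets ?X" .
qed auto

section \<open>Weights, weighted quantiles and the miss criterion for realized vectors\<close>

lemma wt_pos: "0 < \<pi> x \<Longrightarrow> \<pi> x < 1 \<Longrightarrow> 0 < wt \<pi> x"
  by (simp add: wt_def)

text \<open>Among the indices whose upper tail is light, take one with the smallest score. All the
  others lie in its upper tail, so their joint weight is at most that of this single tail. Ties do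
  no harm because the tail is closed.\<close>

lemma weighted_quantile_bound:
  fixes r V :: "'a \<Rightarrow> real"
  assumes "finite A" "\<And>j. j \<in> A \<Longrightarrow> 0 \<le> r j" "0 \<le> \<alpha>"
  shows "(\<Sum>i\<in>A. r i * of_bool ((\<Sum>j\<in>A. r j * of_bool (V i \<le> V j)) \<le> \<alpha> * sum r A)) \<le> \<alpha> * sum r A"
proof -
  define B where "B = {i\<in>A. (\<Sum>j\<in>A. r j * of_bool (V i \<le> V j)) \<le> \<alpha> * sum r A}"
  have "finite B"
    using assms(1) by (simp add: B_def)
  have eq: "(\<Sum>i\<in>A. r i * of_bool ((\<Sum>j\<in>A. r j * of_bool (V i \<le> V j)) \<le> \<alpha> * sum r A)) = sum r B"
    unfolding B_def using assms(1) by (intro sum.mono_neutral_cong_right) auto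
  show ?thesis
  proof (cases "B = {}")
    case True
    then show ?thesis
      unfolding eq using assms by (simp add: sum_nonneg)
  next
    case False
    then obtain k where k: "k \<in> B" "\<And>j. j \<in> B \<Longrightarrow> V k \<le> V j"
      using arg_min_if_finite[OF \<open>finite B\<close> False, of V] by (metis linorder_not_less)
    have "sum r B = (\<Sum>j\<in>B. r j * of_bool (V k \<le> V j))"
      using k by (intro sum.cong) auto
    also have "\<dots> \<le> (\<Sum>j\<in>A. r j * of_bool (V k \<le> V j))"
      using assms by (intro sum_mono2) (auto simp: B_def)
    also have "\<dots> \<le> \<alpha> * sum r A"
      using k(1) by (simp add: B_def)
    finally show ?thesis
      unfolding eq .
  qed
qed

text \<open>For an affected unit the indicator in \<open>correction\<close> is the complement of the
  one in \<open>p_obs\<close>, so in the sum of the two an affected unit contributes its full weight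
  whatever its score. The right-hand side is thus free of the exposures and outcomes of affected
  units.\<close>

lemma not_in_ia_wcp_set_iff:
  fixes S :: "'x \<times> 'e \<times> 'y \<Rightarrow> real"
  assumes pos: "\<And>j. j \<in> {1..N} \<Longrightarrow> 0 < wt \<pi> (x j)" and i: "i \<in> {1..N}" and y: "y \<in> space MY"
  shows "y \<notin> ia_wcp_set N MY \<pi> Nb S \<alpha> x t e y1 i \<longleftrightarrow>
    wt \<pi> (x i) + (\<Sum>j\<in>treated N t. wt \<pi> (x j) * of_bool (i \<in> Nb j x \<or> S (x i, e i, y) \<le> S (x j, e j, y1 j)))
     \<le> \<alpha> * (wt \<pi> (x i) + (\<Sum>j\<in>treated N t. wt \<pi> (x j)))"
    (is "_ \<longleftrightarrow> ?R \<le> \<alpha> * ?D")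
proof -
  have fin: "finite (treated N t)"
    by (simp add: treated_def)
  have pos': "0 < wt \<pi> (x j)" if "j \<in> treated N t" for j
    using that pos by (simp add: treated_def)
  have D: "0 < ?D"
    using pos[OF i] by (intro add_pos_nonneg sum_nonneg) (auto dest: pos' intro: less_imp_le)
  \<comment> \<open>The test unit's own weight makes \<open>p_obs\<close> strictly positive. The
    positive part in the threshold therefore disappears: a miss means that \<open>p_obs\<close> plus
    \<open>correction\<close> is at most \<alpha>.\<close>
  have p: "0 < p_obs N \<pi> S x t e y1 i y"
    unfolding p_obs_def using pos[OF i] D
    by (intro divide_pos_pos add_pos_nonneg sum_nonneg) (auto dest: pos' intro: less_imp_le)
  \<comment> \<open>The restriction to affected units moves into the indicator, so that the sum can
    be added to that of \<open>p_obs\<close> term by term.\<close>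
  have c: "correction N \<pi> Nb S x t e y1 i y =
     (\<Sum>j\<in>treated N t. wt \<pi> (x j) * of_bool (i \<in> Nb j x \<and> S (x j, e j, y1 j) < S (x i, e i, y))) / ?D"
    unfolding correction_def affected_def using fin
    by (intro arg_cong2[where f = "(/)"] sum.mono_neutral_cong_left) auto
  have "p_obs N \<pi> S x t e y1 i y + correction N \<pi> Nb S x t e y1 i y = ?R / ?D"
    unfolding c p_obs_def add_divide_distrib[symmetric] add.assoc sum.distrib[symmetric] distrib_left[symmetric]
    by (intro arg_cong2[where f = "(/)"] arg_cong2[where f = "(+)"] arg_cong2[where f = "(*)"] sum.cong refl)
      (auto simp: of_bool_def)
  moreover have "y \<notin> ia_wcp_set N MY \<pi> Nb S \<alpha> x t e y1 i \<longleftrightarrow>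
      p_obs N \<pi> S x t e y1 i y + correction N \<pi> Nb S x t e y1 i y \<le> \<alpha>"
    unfolding ia_wcp_set_def using y p by auto
  ultimately show ?thesis
    using D by (simp add: divide_le_eq)
qed

section \<open>Bounded weights and the likelihood ratio of treatment vectors\<close>

context networked_interference
begin

abbreviation (input) "SX \<equiv> unit_space N MX"
abbreviation (input) "ST \<equiv> unit_space N (count_space (UNIV :: bool set))"
abbreviation (input) "SE \<equiv> unit_space N ME"
abbreviation "Xv \<equiv> unit_vec N X"
abbreviation "Tv \<equiv> unit_vec N T"
abbreviation "Ev \<equiv> unit_vec N E"

lemma Xv_measurable: "Xv \<in> M \<rightarrow>\<^sub>M SX"
  and Tv_measurable: "Tv \<in> M \<rightarrow>\<^sub>M ST"
  and Ev_measurable: "Ev \<in> M \<rightarrow>\<^sub>M SE"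
  by (intro measurable_restrict X_measurable T_measurable E_measurable; assumption)+

lemma X_space: "i \<in> {1..N} \<Longrightarrow> w \<in> space M \<Longrightarrow> X i w \<in> space MX"
  using X_measurable by (auto dest: measurable_space)

lemma coord_space: "x \<in> space SX \<Longrightarrow> i \<in> {1..N} \<Longrightarrow> x i \<in> space MX"
  by (auto simp: space_PiM)

lemma wt_measurable: "wt \<pi> \<in> borel_measurable MX"
  unfolding wt_def using \<pi>_measurable by measurable

text \<open>Overlap gives the bound. It is taken to be at least 1 so that the same constant also
  bounds the unweighted density in the comparisons below.\<close>

lemma wt_bounded:
  obtains c where "1 \<le> c" "\<And>x. x \<in> space MX \<Longrightarrow> 0 < wt \<pi> x \<and> wt \<pi> x \<le> c"
proof -
  from overlap obtain c :: real where c: "0 < c" "c \<le> 1/2" "\<And>x. x \<in> space MX \<Longrightarrow> c \<le> \<pi> x"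
    by auto
  show thesis
  proof (rule that[of "1 / c"])
    show "1 \<le> 1 / c"
      using c by (simp add: field_simps)
    fix x assume x: "x \<in> space MX"
    have "wt \<pi> x \<le> 1 / \<pi> x"
      unfolding wt_def using \<pi>_range[OF x] by (intro divide_right_mono) auto
    also have "\<dots> \<le> 1 / c"
      using c x by (intro divide_left_mono mult_pos_pos) (auto simp: \<pi>_range)
    finally show "0 < wt \<pi> x \<and> wt \<pi> x \<le> 1 / c"
      using \<pi>_range[OF x] by (simp add: wt_pos)
  qed
qed

lemma treatment_integral:
  assumes J: "J \<subseteq> {1..N}" and f: "f \<in> borel_measurable SX" "\<And>x. x \<in> space SX \<Longrightarrow> \<bar>f x\<bar> \<le> c"
  shows "(\<integral>w. f (Xv w) * of_bool (\<forall>j\<in>J. T j w = t j) \<partial>M) =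
    (\<integral>w. f (Xv w) * (\<Prod>j\<in>J. if t j then \<pi> (X j w) else 1 - \<pi> (X j w)) \<partial>M)"
proof -
  have "(\<integral>w. f (Xv w) * of_bool (\<forall>j\<in>J. T j w = t j) \<partial>M) =
    (\<integral>w. f (Xv w) * indicator {w\<in>space M. \<forall>j\<in>J. T j w \<in> {t j}} w \<partial>M)"
    by (intro Bochner_Integration.integral_cong) (auto simp: indicator_def)
  also have "\<dots> = (\<integral>w. f (Xv w) * (\<Prod>j\<in>J. if t j then \<pi> (Xv w j) else 1 - \<pi> (Xv w j)) \<partial>M)"
  proof (rule cond_law_rectangle[OF Xv_measurable T_measurable _ J T_indep T_law _ f,
        where k = "\<lambda>j x. if t j then \<pi> (x j) else 1 - \<pi> (x j)"])
    fix j assume "j \<in> J"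
    then have j: "j \<in> {1..N}"
      using J by auto
    have [measurable]: "(\<lambda>x. \<pi> (x j)) \<in> borel_measurable SX"
      using j by (intro measurable_compose[OF _ \<pi>_measurable]) measurable
    show "(\<lambda>x. if t j then \<pi> (x j) else 1 - \<pi> (x j)) \<in> borel_measurable SX"
      by measurable
    fix w assume "w \<in> space M"
    then show "measure (measure_pmf (bernoulli_pmf (\<pi> (X j w)))) {t j} = (if t j then \<pi> (Xv w j) else 1 - \<pi> (Xv w j))"
      using \<pi>_range[OF X_space[OF j]] j by (cases "t j") (auto simp: measure_pmf_single less_imp_le)
  qed (use J in auto)
  also have "\<dots> = (\<integral>w. f (Xv w) * (\<Prod>j\<in>J. if t j then \<pi> (X j w) else 1 - \<pi> (X j w)) \<partial>M)"
    using J by (intro Bochner_Integration.integral_cong arg_cong2[where f = "(*)"] prod.cong) auto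
  finally show ?thesis .
qed

lemma wt_coord_measurable: "i \<in> {1..N} \<Longrightarrow> (\<lambda>x. wt \<pi> (x i)) \<in> borel_measurable SX"
  by (rule measurable_compose[OF _ wt_measurable]) measurable

text \<open>The conditional likelihoods of the two treatment vectors differ only in the factor of
  \<open>i\<close>, and the odds weight turns \<pi> into 1 - \<pi>. \<open>J\<close> is kept
  general: it is \<open>{1..N}\<close> for the laws of the data and \<open>{i}\<close> for the
  probability of being untreated.\<close>

lemma treatment_flip:
  assumes J: "J \<subseteq> {1..N}" and i: "i \<in> J" "\<not> t i"
    and f: "f \<in> borel_measurable SX" "\<And>x. x \<in> space SX \<Longrightarrow> \<bar>f x\<bar> \<le> c"
  shows "(\<integral>w. f (Xv w) * of_bool (\<forall>j\<in>J. T j w = t j) \<partial>M) =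
    (\<integral>w. f (Xv w) * wt \<pi> (X i w) * of_bool (\<forall>j\<in>J. T j w = (t(i := True)) j) \<partial>M)"
proof -
  obtain d where d: "1 \<le> d" "\<And>x. x \<in> space MX \<Longrightarrow> 0 < wt \<pi> x \<and> wt \<pi> x \<le> d"
    by (rule wt_bounded) blast
  have iN: "i \<in> {1..N}"
    using i J by auto
  have fin: "finite J"
    using J by (rule finite_subset) simp
  let ?g = "\<lambda>x. f x * wt \<pi> (x i)"
  have g: "?g \<in> borel_measurable SX"
    using f(1) wt_coord_measurable[OF iN] by measurable
  have g': "\<bar>?g x\<bar> \<le> c * d" if "x \<in> space SX" for x
    unfolding abs_mult using f(2)[OF that] d(2)[OF coord_space[OF that iN]] by (intro mult_mono) auto
  have prod: "wt \<pi> (X i w) * (\<Prod>j\<in>J. if (t(i := True)) j then \<pi> (X j w) else 1 - \<pi> (X j w)) =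
     (\<Prod>j\<in>J. if t j then \<pi> (X j w) else 1 - \<pi> (X j w))" if w: "w \<in> space M" for w
  proof -
    have "(\<Prod>j\<in>J - {i}. if (t(i := True)) j then \<pi> (X j w) else 1 - \<pi> (X j w)) =
      (\<Prod>j\<in>J - {i}. if t j then \<pi> (X j w) else 1 - \<pi> (X j w))"
      by (intro prod.cong) auto
    moreover have "wt \<pi> (X i w) * \<pi> (X i w) = 1 - \<pi> (X i w)"
      using \<pi>_range[OF X_space[OF iN w]] by (simp add: wt_def)
    ultimately show ?thesis
      using i by (simp add: prod.remove[OF fin i(1)] flip: mult.assoc)
  qed
  have "(\<integral>w. f (Xv w) * wt \<pi> (X i w) * of_bool (\<forall>j\<in>J. T j w = (t(i := True)) j) \<partial>M) =
    (\<integral>w. ?g (Xv w) * of_bool (\<forall>j\<in>J. T j w = (t(i := True)) j) \<partial>M)"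
    using iN by simp
  also have "\<dots> = (\<integral>w. ?g (Xv w) * (\<Prod>j\<in>J. if (t(i := True)) j then \<pi> (X j w) else 1 - \<pi> (X j w)) \<partial>M)"
    by (rule treatment_integral[OF J g g'])
  also have "\<dots> = (\<integral>w. f (Xv w) * (wt \<pi> (X i w) * (\<Prod>j\<in>J. if (t(i := True)) j then \<pi> (X j w) else 1 - \<pi> (X j w))) \<partial>M)"
    using iN by (simp only: mult.assoc restrict_apply if_True)
  also have "\<dots> = (\<integral>w. f (Xv w) * (\<Prod>j\<in>J. if t j then \<pi> (X j w) else 1 - \<pi> (X j w)) \<partial>M)"
    by (intro Bochner_Integration.integral_cong refl) (simp only: prod)
  also have "\<dots> = (\<integral>w. f (Xv w) * of_bool (\<forall>j\<in>J. T j w = t j) \<partial>M)"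
    by (rule treatment_integral[OF J f, symmetric])
  finally show ?thesis ..
qed

lemma local_config_cong:
  "(\<And>j. j \<in> Nb i x \<Longrightarrow> s j = t j) \<Longrightarrow> local_config Nb i x s = local_config Nb i x t"
  unfolding local_config_def
  by (cases "finite (Nb i x)") (auto intro!: image_mset_cong)

lemma PE_config_measurable:
  assumes "j \<in> {1..N}"
  shows "(\<lambda>x. PE (x j, local_config Nb j x t)) \<in> SX \<rightarrow>\<^sub>M prob_algebra ME"
proof -
  have "(\<lambda>x. local_config Nb j x t) \<in> SX \<rightarrow>\<^sub>M multiset_space (MX \<Otimes>\<^sub>M count_space UNIV)"
    using Nb_subset[OF assms] Nb_measurable[OF assms] by (intro local_config_measurable) auto
  then show ?thesis
    using assms by (intro measurable_compose[OF _ PE_kernel] measurable_Pair) auto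
qed

text \<open>Joint independence of the pairs of potential outcomes is applied to sets whose component
  for treatment 0 is the whole space.\<close>

lemma Y_indep1:
  "cond_indep_vars M (SX \<Otimes>\<^sub>M SE \<Otimes>\<^sub>M ST) (\<lambda>w. (Xv w, Ev w, Tv w)) MY (\<lambda>i. Y i True) {1..N}"
  unfolding cond_indep_vars_def
proof
  fix B assume B: "B \<in> {1..N} \<rightarrow> sets MY"
  have *: "{v \<in> space M. (Y i False v, Y i True v) \<in> space MY \<times> B i} = {v \<in> space M. Y i True v \<in> B i}"
    if "i \<in> {1..N}" for i
    using measurable_space[OF Y_measurable[OF that]] by auto
  have **: "{v \<in> space M. \<forall>i\<in>{1..N}. (Y i False v, Y i True v) \<in> space MY \<times> B i} =
      {v \<in> space M. \<forall>i\<in>{1..N}. Y i True v \<in> B i}"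
    using measurable_space[OF Y_measurable] by auto
  have "(\<lambda>i. space MY \<times> B i) \<in> {1..N} \<rightarrow> sets (MY \<Otimes>\<^sub>M MY)"
    using B by (auto intro!: pair_measureI)
  with Y_indep have "AE w in M. cond_pr M (SX \<Otimes>\<^sub>M SE \<Otimes>\<^sub>M ST) (\<lambda>w. (Xv w, Ev w, Tv w))
       {v \<in> space M. \<forall>i\<in>{1..N}. (Y i False v, Y i True v) \<in> space MY \<times> B i} w =
     (\<Prod>i\<in>{1..N}. cond_pr M (SX \<Otimes>\<^sub>M SE \<Otimes>\<^sub>M ST) (\<lambda>w. (Xv w, Ev w, Tv w))
       {v \<in> space M. (Y i False v, Y i True v) \<in> space MY \<times> B i} w)"
    unfolding cond_indep_vars_def by (rule bspec)
  then show "AE w in M. cond_pr M (SX \<Otimes>\<^sub>M SE \<Otimes>\<^sub>M ST) (\<lambda>w. (Xv w, Ev w, Tv w))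
       {v \<in> space M. \<forall>i\<in>{1..N}. Y i True v \<in> B i} w =
     (\<Prod>i\<in>{1..N}. cond_pr M (SX \<Otimes>\<^sub>M SE \<Otimes>\<^sub>M ST) (\<lambda>w. (Xv w, Ev w, Tv w))
       {v \<in> space M. Y i True v \<in> B i} w)"
    unfolding ** by (simp only: * cong: prod.cong)
qed

section \<open>Invariance of the law of covariates, exposures and outcomes under the flip\<close>

text \<open>A weight relative to the model law, not a probability density. \<open>D\<close> will fix
  which units have \<open>i\<close> as a neighbor. Its counterpart \<open>flip_density\<close> sits
  on \<open>t(i := True)\<close> and carries the odds weight that compensates for the changed
  treatment probability.\<close>

definition treat_density :: "(nat \<Rightarrow> 'x) set \<Rightarrow> (nat \<Rightarrow> bool) \<Rightarrow> (nat \<Rightarrow> 'x) \<Rightarrow> (nat \<Rightarrow> bool) \<Rightarrow> real" where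
  "treat_density D t x s = indicator D x * of_bool (\<forall>j\<in>{1..N}. s j = t j)"

definition flip_density ::
  "nat \<Rightarrow> (nat \<Rightarrow> 'x) set \<Rightarrow> (nat \<Rightarrow> bool) \<Rightarrow> (nat \<Rightarrow> 'x) \<Rightarrow> (nat \<Rightarrow> bool) \<Rightarrow> real" where
  "flip_density i D t x s = wt \<pi> (x i) * treat_density D (t(i := True)) x s"

lemma treat_density_measurable:
  assumes "D \<in> sets SX"
  shows "(\<lambda>(x, s). treat_density D t x s) \<in> borel_measurable (SX \<Otimes>\<^sub>M ST)"
proof -
  have [measurable]: "(\<lambda>s. s j) \<in> ST \<rightarrow>\<^sub>M count_space UNIV" if "j \<in> {1..N}" for j
    using that by measurable
  have "Measurable.pred ST (\<lambda>s. \<forall>j\<in>{1..N}. s j = t j)"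
    by measurable
  then show ?thesis
    unfolding treat_density_def of_bool_def using assms by measurable
qed

lemma flip_density_measurable:
  assumes "i \<in> {1..N}" "D \<in> sets SX"
  shows "(\<lambda>(x, s). flip_density i D t x s) \<in> borel_measurable (SX \<Otimes>\<^sub>M ST)"
  unfolding flip_density_def
  using treat_density_measurable[OF assms(2)] wt_coord_measurable[OF assms(1)] by measurable

lemma treat_density_bounds: "0 \<le> treat_density D t x s" "treat_density D t x s \<le> 1"
  by (auto simp: treat_density_def indicator_def)

lemma flip_density_bounded:
  assumes i: "i \<in> {1..N}"
  obtains d where "1 \<le> d"
    "\<And>D t x s. x \<in> space SX \<Longrightarrow> 0 \<le> flip_density i D t x s"
    "\<And>D t x s. x \<in> space SX \<Longrightarrow> flip_density i D t x s \<le> d"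
proof -
  obtain d where d: "1 \<le> d" "\<And>x. x \<in> space MX \<Longrightarrow> 0 < wt \<pi> x \<and> wt \<pi> x \<le> d"
    by (rule wt_bounded) blast
  have "0 \<le> flip_density i D t x s \<and> flip_density i D t x s \<le> d" if "x \<in> space SX" for D t x s
    using d(1) d(2)[OF coord_space[OF that i]] by (auto simp: flip_density_def treat_density_def indicator_def)
  with d(1) show thesis
    by (blast intro: that)
qed

lemma treat_density_random_variable:
  assumes "D \<in> sets SX"
  shows "(\<lambda>w. treat_density D t (Xv w) (Tv w)) \<in> borel_measurable M"
  using measurable_compose[OF measurable_Pair[OF Xv_measurable Tv_measurable] treat_density_measurable[OF assms]]
  by simp

lemma flip_density_random_variable:
  assumes "i \<in> {1..N}" "D \<in> sets SX"
  shows "(\<lambda>w. flip_density i D t (Xv w) (Tv w)) \<in> borel_measurable M"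
  using measurable_compose[OF measurable_Pair[OF Xv_measurable Tv_measurable] flip_density_measurable[OF assms]]
  by simp

text \<open>First layer: on a set \<open>C\<close> the claim is \<open>treatment_flip\<close> for
  the indicator of \<open>C \<inter> D\<close>.\<close>

lemma tilted_law_covariates:
  assumes i: "i \<in> {1..N}" "\<not> t i" and D: "D \<in> sets SX"
  shows "tilted_law M (\<lambda>w. treat_density D t (Xv w) (Tv w)) SX Xv =
    tilted_law M (\<lambda>w. flip_density i D t (Xv w) (Tv w)) SX Xv"
proof (rule measure_eqI)
  obtain d where d: "1 \<le> d"
    and vb: "\<And>D t x s. x \<in> space SX \<Longrightarrow> 0 \<le> flip_density i D t x s"
      "\<And>D t x s. x \<in> space SX \<Longrightarrow> flip_density i D t x s \<le> d"
    by (rule flip_density_bounded[OF i(1)]) blast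
  fix C assume "C \<in> sets (tilted_law M (\<lambda>w. treat_density D t (Xv w) (Tv w)) SX Xv)"
  then have C: "C \<in> sets SX"
    by simp
  have u: "(\<lambda>w. treat_density D t (Xv w) (Tv w)) \<in> borel_measurable M"
    by (rule treat_density_random_variable[OF D])
  have v: "(\<lambda>w. flip_density i D t (Xv w) (Tv w)) \<in> borel_measurable M"
    by (rule flip_density_random_variable[OF i(1) D])
  note v0 = vb[OF measurable_space[OF Xv_measurable]]
  have "(\<integral>w. treat_density D t (Xv w) (Tv w) * indicator C (Xv w) \<partial>M) =
     (\<integral>w. indicator (C \<inter> D) (Xv w) * of_bool (\<forall>j\<in>{1..N}. T j w = t j) \<partial>M)"
    by (intro Bochner_Integration.integral_cong) (auto simp: treat_density_def indicator_def)
  also have "\<dots> = (\<integral>w. indicator (C \<inter> D) (Xv w) * wt \<pi> (X i w) * of_bool (\<forall>j\<in>{1..N}. T j w = (t(i := True)) j) \<partial>M)"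
    using i C D by (intro treatment_flip[where c = 1]) (auto simp: indicator_def)
  also have "\<dots> = (\<integral>w. flip_density i D t (Xv w) (Tv w) * indicator C (Xv w) \<partial>M)"
    using i(1) by (intro Bochner_Integration.integral_cong) (auto simp: flip_density_def treat_density_def indicator_def)
  finally show "emeasure (tilted_law M (\<lambda>w. treat_density D t (Xv w) (Tv w)) SX Xv) C =
     emeasure (tilted_law M (\<lambda>w. flip_density i D t (Xv w) (Tv w)) SX Xv) C"
    using emeasure_tilted_law[OF Xv_measurable u _ _ C, of 1] emeasure_tilted_law[OF Xv_measurable v v0 C]
    by (simp add: treat_density_bounds)
qed simp

text \<open>Second layer: for covariates in \<open>D\<close> no unit of \<open>J\<close> has
  \<open>i\<close> as a neighbor, so the local configurations of these units do not register the
  treatment of \<open>i\<close>, and their exposure kernels are the same under both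
  densities.\<close>

lemma tilted_law_exposures:
  assumes i: "i \<in> {1..N}" "\<not> t i" and D: "D \<in> sets SX" and J: "J \<subseteq> {1..N}"
    and DJ: "\<forall>x\<in>D. \<forall>j\<in>J. i \<notin> Nb j x"
  shows "tilted_law M (\<lambda>w. treat_density D t (Xv w) (Tv w)) (SX \<Otimes>\<^sub>M PiM J (\<lambda>_. ME)) (\<lambda>w. (Xv w, \<lambda>j\<in>J. E j w)) =
    tilted_law M (\<lambda>w. flip_density i D t (Xv w) (Tv w)) (SX \<Otimes>\<^sub>M PiM J (\<lambda>_. ME)) (\<lambda>w. (Xv w, \<lambda>j\<in>J. E j w))"
proof -
  obtain d where d: "1 \<le> d"
    and vb: "\<And>D t x s. x \<in> space SX \<Longrightarrow> 0 \<le> flip_density i D t x s"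
      "\<And>D t x s. x \<in> space SX \<Longrightarrow> flip_density i D t x s \<le> d"
    by (rule flip_density_bounded[OF i(1)]) blast
  have K: "PE (X j w, local_config Nb j (Xv w) (Tv w)) = PE (Xv w j, local_config Nb j (Xv w) t)"
    if j: "j \<in> J" and w: "w \<in> space M"
      and nz: "treat_density D t (Xv w) (Tv w) \<noteq> 0 \<or> flip_density i D t (Xv w) (Tv w) \<noteq> 0" for j w
  proof -
    have jN: "j \<in> {1..N}"
      using j J by auto
    \<comment> \<open>Either density confines the covariates to \<open>D\<close> and the treatments
      to \<open>t\<close> or \<open>t(i := True)\<close>, which differ only at
      \<open>i\<close>.\<close>
    have XD: "Xv w \<in> D" and T: "\<forall>k\<in>{1..N}. k \<noteq> i \<longrightarrow> T k w = t k"
      using nz by (auto simp: treat_density_def flip_density_def indicator_def split: if_splits)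
    have "local_config Nb j (Xv w) (Tv w) = local_config Nb j (Xv w) t"
    proof (rule local_config_cong)
      fix k assume k: "k \<in> Nb j (Xv w)"
      then have "k \<in> {1..N}"
        using Nb_subset[OF jN measurable_space[OF Xv_measurable w]] by blast
      moreover have "k \<noteq> i"
        using DJ XD j k by blast
      ultimately show "Tv w k = t k"
        using T by simp
    qed
    then show ?thesis
      using jN by simp
  qed
  have "tilted_law M (\<lambda>w. case_prod (treat_density D t) (Xv w, Tv w)) (SX \<Otimes>\<^sub>M PiM J (\<lambda>_. ME))
      (\<lambda>w. (fst (Xv w, Tv w), \<lambda>j\<in>J. E j w)) =
    tilted_law M (\<lambda>w. case_prod (flip_density i D t) (Xv w, Tv w)) (SX \<Otimes>\<^sub>M PiM J (\<lambda>_. ME))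
      (\<lambda>w. (fst (Xv w, Tv w), \<lambda>j\<in>J. E j w))"
  proof (rule tilted_law_transfer[where MA = "SX \<Otimes>\<^sub>M ST" and A = "\<lambda>w. (Xv w, Tv w)" and I = "{1..N}" and c = d
        and K = "\<lambda>j w. PE (X j w, local_config Nb j (Xv w) (Tv w))"
        and \<kappa> = "\<lambda>j x. PE (x j, local_config Nb j x t)"])
    show "tilted_law M (\<lambda>w. case_prod (treat_density D t) (Xv w, Tv w)) SX (\<lambda>w. fst (Xv w, Tv w)) =
        tilted_law M (\<lambda>w. case_prod (flip_density i D t) (Xv w, Tv w)) SX (\<lambda>w. fst (Xv w, Tv w))"
      using tilted_law_covariates[where i = i and t = t, OF i D] by simp
    show "(\<lambda>x. PE (x j, local_config Nb j x t)) \<in> SX \<rightarrow>\<^sub>M prob_algebra ME" if "j \<in> J" for j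
      using that J by (intro PE_config_measurable) auto
    show "cond_law M (SX \<Otimes>\<^sub>M ST) (\<lambda>w. (Xv w, Tv w)) ME (E j) (\<lambda>w. PE (X j w, local_config Nb j (Xv w) (Tv w)))"
      if "j \<in> J" for j
      using that J by (intro E_law) auto
    show "PE (X j w, local_config Nb j (Xv w) (Tv w)) =
        PE (fst (Xv w, Tv w) j, local_config Nb j (fst (Xv w, Tv w)) t)"
      if "j \<in> J" "w \<in> space M"
        "case_prod (treat_density D t) (Xv w, Tv w) \<noteq> 0 \<or> case_prod (flip_density i D t) (Xv w, Tv w) \<noteq> 0" for j w
      using K[OF that(1,2)] that(3) by simp
    show "case_prod (treat_density D t) a \<le> d" for a
      using treat_density_bounds(2)[of D t "fst a" "snd a"] d by (simp add: case_prod_beta)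
    show "case_prod (treat_density D t) a \<ge> 0" for a
      by (simp add: case_prod_beta treat_density_bounds)
    show "case_prod (flip_density i D t) a \<le> d" "case_prod (flip_density i D t) a \<ge> 0" if "a \<in> space (SX \<Otimes>\<^sub>M ST)" for a
      using vb[of "fst a"] that by (auto simp: case_prod_beta space_pair_measure)
    show "(\<lambda>w. (Xv w, Tv w)) \<in> M \<rightarrow>\<^sub>M SX \<Otimes>\<^sub>M ST"
      by (intro measurable_Pair Xv_measurable Tv_measurable)
    show "case_prod (treat_density D t) \<in> borel_measurable (SX \<Otimes>\<^sub>M ST)"
      by (rule treat_density_measurable[OF D])
    show "case_prod (flip_density i D t) \<in> borel_measurable (SX \<Otimes>\<^sub>M ST)"
      by (rule flip_density_measurable[OF i(1) D])
  qed (rule E_measurable E_indep J measurable_fst finite_atLeastAtMost; assumption?)+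
  then show ?thesis
    by simp
qed

text \<open>Third layer: the outcome kernel of \<open>j\<close> sees only the covariate and exposure
  of \<open>j\<close> itself, whose joint law over \<open>J\<close> was compared in the second
  layer.\<close>

lemma tilted_law_outcomes:
  assumes i: "i \<in> {1..N}" "\<not> t i" and D: "D \<in> sets SX" and J: "J \<subseteq> {1..N}"
    and DJ: "\<forall>x\<in>D. \<forall>j\<in>J. i \<notin> Nb j x"
  shows "tilted_law M (\<lambda>w. treat_density D t (Xv w) (Tv w)) ((SX \<Otimes>\<^sub>M PiM J (\<lambda>_. ME)) \<Otimes>\<^sub>M PiM J (\<lambda>_. MY))
      (\<lambda>w. ((Xv w, \<lambda>j\<in>J. E j w), \<lambda>j\<in>J. Y j True w)) =
    tilted_law M (\<lambda>w. flip_density i D t (Xv w) (Tv w)) ((SX \<Otimes>\<^sub>M PiM J (\<lambda>_. ME)) \<Otimes>\<^sub>M PiM J (\<lambda>_. MY))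
      (\<lambda>w. ((Xv w, \<lambda>j\<in>J. E j w), \<lambda>j\<in>J. Y j True w))"
proof -
  obtain d where d: "1 \<le> d"
    and vb: "\<And>D t x s. x \<in> space SX \<Longrightarrow> 0 \<le> flip_density i D t x s"
      "\<And>D t x s. x \<in> space SX \<Longrightarrow> flip_density i D t x s \<le> d"
    by (rule flip_density_bounded[OF i(1)]) blast
  define u where "u = (\<lambda>a :: (nat \<Rightarrow> 'x) \<times> (nat \<Rightarrow> 'e) \<times> (nat \<Rightarrow> bool). treat_density D t (fst a) (snd (snd a)))"
  define v where "v = (\<lambda>a :: (nat \<Rightarrow> 'x) \<times> (nat \<Rightarrow> 'e) \<times> (nat \<Rightarrow> bool). flip_density i D t (fst a) (snd (snd a)))"
  \<comment> \<open>Forgets the treatments, on which the two densities disagree, and the exposures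
    outside \<open>J\<close>, whose laws may change under the flip.\<close>
  define g where "g = (\<lambda>a :: (nat \<Rightarrow> 'x) \<times> (nat \<Rightarrow> 'e) \<times> (nat \<Rightarrow> bool). (fst a, \<lambda>j\<in>J. fst (snd a) j))"
  let ?A = "\<lambda>w. (Xv w, Ev w, Tv w)" and ?MA = "SX \<Otimes>\<^sub>M SE \<Otimes>\<^sub>M ST"
  have gA: "g (?A w) = (Xv w, \<lambda>j\<in>J. E j w)" for w
    using J by (auto simp: g_def Int_absorb1)
  have uA: "u (?A w) = treat_density D t (Xv w) (Tv w)" and vA: "v (?A w) = flip_density i D t (Xv w) (Tv w)" for w
    by (simp_all add: u_def v_def)
  have proj: "(\<lambda>a. (fst a, snd (snd a))) \<in> ?MA \<rightarrow>\<^sub>M SX \<Otimes>\<^sub>M ST"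
    by measurable
  have u: "u \<in> borel_measurable ?MA"
    unfolding u_def using measurable_compose[OF proj treat_density_measurable[OF D]] by simp
  have v: "v \<in> borel_measurable ?MA"
    unfolding v_def using measurable_compose[OF proj flip_density_measurable[OF i(1) D]] by simp
  have g: "g \<in> ?MA \<rightarrow>\<^sub>M SX \<Otimes>\<^sub>M PiM J (\<lambda>_. ME)"
    unfolding g_def
  proof (intro measurable_Pair measurable_restrict)
    fix j assume "j \<in> J"
    then have "j \<in> {1..N}"
      using J by auto
    then show "(\<lambda>a. fst (snd a) j) \<in> ?MA \<rightarrow>\<^sub>M ME"
      by measurable
  qed measurable
  have "tilted_law M (\<lambda>w. u (?A w)) ((SX \<Otimes>\<^sub>M PiM J (\<lambda>_. ME)) \<Otimes>\<^sub>M PiM J (\<lambda>_. MY)) (\<lambda>w. (g (?A w), \<lambda>j\<in>J. Y j True w)) =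
    tilted_law M (\<lambda>w. v (?A w)) ((SX \<Otimes>\<^sub>M PiM J (\<lambda>_. ME)) \<Otimes>\<^sub>M PiM J (\<lambda>_. MY)) (\<lambda>w. (g (?A w), \<lambda>j\<in>J. Y j True w))"
  proof (rule tilted_law_transfer[where MA = ?MA and A = ?A and I = "{1..N}" and c = d
        and K = "\<lambda>j w. PY True (X j w, E j w)" and \<kappa> = "\<lambda>j a. PY True (fst a j, snd a j)" and g = g and u = u and v = v])
    show "tilted_law M (\<lambda>w. u (?A w)) (SX \<Otimes>\<^sub>M PiM J (\<lambda>_. ME)) (\<lambda>w. g (?A w)) =
        tilted_law M (\<lambda>w. v (?A w)) (SX \<Otimes>\<^sub>M PiM J (\<lambda>_. ME)) (\<lambda>w. g (?A w))"
      unfolding gA uA vA by (rule tilted_law_exposures[where i = i and t = t, OF i D J DJ])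
    show "?A \<in> M \<rightarrow>\<^sub>M ?MA"
      by (intro measurable_Pair Xv_measurable Tv_measurable Ev_measurable)
    show "Y j True \<in> M \<rightarrow>\<^sub>M MY" if "j \<in> {1..N}" for j
      by (rule Y_measurable[OF that])
    show "cond_indep_vars M ?MA ?A MY (\<lambda>j. Y j True) {1..N}"
      by (rule Y_indep1)
    fix j assume jJ: "j \<in> J"
    then have j: "j \<in> {1..N}"
      using J by auto
    show "cond_law M ?MA ?A MY (Y j True) (\<lambda>w. PY True (X j w, E j w))"
      by (rule Y_law[OF j])
    show "(\<lambda>a. PY True (fst a j, snd a j)) \<in> SX \<Otimes>\<^sub>M PiM J (\<lambda>_. ME) \<rightarrow>\<^sub>M prob_algebra MY"
      using j jJ by (intro measurable_compose[OF _ PY_kernel] measurable_Pair) measurable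
    show "PY True (X j w, E j w) = PY True (fst (g (?A w)) j, snd (g (?A w)) j)" for w
      unfolding gA using j jJ by simp
  next
    fix a assume a: "a \<in> space ?MA"
    show "0 \<le> u a" "u a \<le> d"
      using treat_density_bounds[of D t "fst a" "snd (snd a)"] d by (simp_all add: u_def)
    show "0 \<le> v a" "v a \<le> d"
      using vb[of "fst a"] a by (auto simp: v_def space_pair_measure)
  qed (use g u v J in auto)
  then show ?thesis
    unfolding gA uA vA .
qed

end

section \<open>Coverage\<close>

context networked_interference
begin

text \<open>Reads the equality of tilted laws off on one event. Integrability comes along for
  exchanging finite sums with integrals in \<open>prob_miss_le\<close>.\<close>

lemma flip_integral:
  assumes i: "i \<in> {1..N}" "\<not> t i" and D: "D \<in> sets SX" and J: "J \<subseteq> {1..N}"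
    and DJ: "\<forall>x\<in>D. \<forall>j\<in>J. i \<notin> Nb j x"
    and F: "F \<in> sets ((SX \<Otimes>\<^sub>M PiM J (\<lambda>_. ME)) \<Otimes>\<^sub>M PiM J (\<lambda>_. MY))"
  defines "Q \<equiv> \<lambda>w. ((Xv w, \<lambda>j\<in>J. E j w), \<lambda>j\<in>J. Y j True w)"
  shows "(\<integral>w. treat_density D t (Xv w) (Tv w) * indicator F (Q w) \<partial>M) =
      (\<integral>w. flip_density i D t (Xv w) (Tv w) * indicator F (Q w) \<partial>M)"
    and "integrable M (\<lambda>w. treat_density D t (Xv w) (Tv w) * indicator F (Q w) :: real)"
    and "integrable M (\<lambda>w. flip_density i D t (Xv w) (Tv w) * indicator F (Q w) :: real)"
proof -
  obtain d where d: "1 \<le> d"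
    and vb: "\<And>D t x s. x \<in> space SX \<Longrightarrow> 0 \<le> flip_density i D t x s"
      "\<And>D t x s. x \<in> space SX \<Longrightarrow> flip_density i D t x s \<le> d"
    by (rule flip_density_bounded[OF i(1)]) blast
  have Q: "Q \<in> M \<rightarrow>\<^sub>M (SX \<Otimes>\<^sub>M PiM J (\<lambda>_. ME)) \<Otimes>\<^sub>M PiM J (\<lambda>_. MY)"
    unfolding Q_def using J
    by (intro measurable_Pair Xv_measurable measurable_restrict E_measurable Y_measurable) auto
  have u: "(\<lambda>w. treat_density D t (Xv w) (Tv w)) \<in> borel_measurable M"
    by (rule treat_density_random_variable[OF D])
  have v: "(\<lambda>w. flip_density i D t (Xv w) (Tv w)) \<in> borel_measurable M"
    by (rule flip_density_random_variable[OF i(1) D])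
  note v0 = vb[OF measurable_space[OF Xv_measurable]]
  have F': "(indicator F :: _ \<Rightarrow> real) \<in> borel_measurable ((SX \<Otimes>\<^sub>M PiM J (\<lambda>_. ME)) \<Otimes>\<^sub>M PiM J (\<lambda>_. MY))"
    using F by (rule borel_measurable_indicator)
  have FQ: "(\<lambda>w. indicator F (Q w) :: real) \<in> borel_measurable M"
    using Q F' by (rule measurable_compose)
  have "(\<integral>w. treat_density D t (Xv w) (Tv w) * indicator F (Q w) \<partial>M) =
     (\<integral>z. indicator F z \<partial>tilted_law M (\<lambda>w. treat_density D t (Xv w) (Tv w)) ((SX \<Otimes>\<^sub>M PiM J (\<lambda>_. ME)) \<Otimes>\<^sub>M PiM J (\<lambda>_. MY)) Q)"
    by (rule integral_tilted_law[OF Q u treat_density_bounds(1) F', symmetric])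
  also have "\<dots> = (\<integral>z. indicator F z \<partial>tilted_law M (\<lambda>w. flip_density i D t (Xv w) (Tv w)) ((SX \<Otimes>\<^sub>M PiM J (\<lambda>_. ME)) \<Otimes>\<^sub>M PiM J (\<lambda>_. MY)) Q)"
    unfolding Q_def tilted_law_outcomes[where i = i and t = t, OF i D J DJ] ..
  also have "\<dots> = (\<integral>w. flip_density i D t (Xv w) (Tv w) * indicator F (Q w) \<partial>M)"
    by (rule integral_tilted_law[OF Q v v0(1) F'])
  finally show "(\<integral>w. treat_density D t (Xv w) (Tv w) * indicator F (Q w) \<partial>M) =
      (\<integral>w. flip_density i D t (Xv w) (Tv w) * indicator F (Q w) \<partial>M)" .
  show "integrable M (\<lambda>w. treat_density D t (Xv w) (Tv w) * indicator F (Q w) :: real)"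
    using u FQ treat_density_bounds
    by (intro integrable_const_bound[of _ 1] AE_I2) (auto simp: indicator_def)
  show "integrable M (\<lambda>w. flip_density i D t (Xv w) (Tv w) * indicator F (Q w) :: real)"
    using v FQ v0 d
    by (intro integrable_const_bound[of _ d] AE_I2) (auto simp: indicator_def)
qed

section \<open>Weights of treated units, extreme scores and misses as random variables\<close>

text \<open>With the treatment indicator inside the weight, sums over the random set of treated
  units become sums over \<open>{1..N}\<close>, which can be exchanged with the integral.\<close>

definition tilt :: "nat \<Rightarrow> 'w \<Rightarrow> real" where
  "tilt j w = of_bool (T j w) * wt \<pi> (X j w)"

lemma tilt_nonneg: "j \<in> {1..N} \<Longrightarrow> w \<in> space M \<Longrightarrow> 0 \<le> tilt j w"
  using \<pi>_range[OF X_space] by (auto simp: tilt_def intro: less_imp_le wt_pos)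

lemma tilt_measurable:
  assumes "j \<in> {1..N}"
  shows "tilt j \<in> borel_measurable M"
proof -
  note [measurable] = measurable_compose[OF X_measurable[OF assms] wt_measurable] T_measurable[OF assms]
  show ?thesis
    unfolding tilt_def of_bool_def by measurable
qed

lemma tilt_integrable:
  assumes "j \<in> {1..N}"
  shows "integrable M (tilt j)"
proof -
  obtain d where d: "1 \<le> d" "\<And>x. x \<in> space MX \<Longrightarrow> 0 < wt \<pi> x \<and> wt \<pi> x \<le> d"
    by (rule wt_bounded) blast
  have "norm (tilt j w) \<le> d" if "w \<in> space M" for w
    using d(1) d(2)[OF X_space[OF assms that]] by (auto simp: tilt_def)
  then show ?thesis
    using tilt_measurable[OF assms] by (intro integrable_const_bound[of _ d] AE_I2) auto
qed

lemma sum_treated: "(\<Sum>j\<in>treated N t. f j) = (\<Sum>j\<in>{1..N}. of_bool (t j) * f j :: real)"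
  unfolding treated_def by (intro sum.mono_neutral_cong_left) auto

text \<open>\<open>treatment_flip\<close> for the single unit \<open>i\<close> and the constant
  function 1. At the end it turns the total weight of the treated units back into the probability of
  the conditioning event.\<close>

lemma prob_untreated:
  assumes i: "i \<in> {1..N}"
  shows "prob {w\<in>space M. \<not> T i w} = (\<integral>w. tilt i w \<partial>M)"
proof -
  have ev: "{w\<in>space M. \<not> T i w} \<in> events"
    using T_measurable[OF i] by measurable
  have "prob {w\<in>space M. \<not> T i w} = (\<integral>w. indicator {w\<in>space M. \<not> T i w} w \<partial>M)"
    using ev by simp
  also have "\<dots> = (\<integral>w. 1 * of_bool (\<forall>j\<in>{i}. T j w = (\<lambda>_. False) j) \<partial>M)"
    by (intro Bochner_Integration.integral_cong) (auto simp: indicator_def)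
  also have "\<dots> = (\<integral>w. 1 * wt \<pi> (X i w) * of_bool (\<forall>j\<in>{i}. T j w = ((\<lambda>_. False)(i := True)) j) \<partial>M)"
    using i by (intro treatment_flip[where f = "\<lambda>_. 1" and c = 1]) auto
  also have "\<dots> = (\<integral>w. tilt i w \<partial>M)"
    by (intro Bochner_Integration.integral_cong) (auto simp: tilt_def)
  finally show ?thesis .
qed

definition score :: "('x \<times> 'e \<times> 'y \<Rightarrow> real) \<Rightarrow> nat \<Rightarrow> 'w \<Rightarrow> real" where
  "score S j w = S (X j w, E j w, Y j True w)"

lemma score_measurable:
  assumes "S \<in> borel_measurable (MX \<Otimes>\<^sub>M ME \<Otimes>\<^sub>M MY)" "j \<in> {1..N}"
  shows "score S j \<in> borel_measurable M"
  unfolding score_def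
  by (intro measurable_compose[OF _ assms(1)] measurable_Pair X_measurable E_measurable Y_measurable assms(2))

text \<open>There is no separate test term: a treated unit \<open>i\<close> is ranked among all
  treated units, itself included. This symmetric form fits \<open>weighted_quantile_bound\<close>
  for all \<open>i\<close> at once.\<close>

definition extreme :: "('x \<times> 'e \<times> 'y \<Rightarrow> real) \<Rightarrow> real \<Rightarrow> nat \<Rightarrow> 'w \<Rightarrow> bool" where
  "extreme S \<alpha> i w \<longleftrightarrow>
     (\<Sum>j\<in>{1..N}. tilt j w * of_bool (score S i w \<le> score S j w)) \<le> \<alpha> * (\<Sum>j\<in>{1..N}. tilt j w)"

lemma tilt_extreme_integrable:
  assumes S: "S \<in> borel_measurable (MX \<Otimes>\<^sub>M ME \<Otimes>\<^sub>M MY)" and i: "i \<in> {1..N}"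
  shows "integrable M (\<lambda>w. tilt i w * of_bool (extreme S \<alpha> i w))"
proof (rule Bochner_Integration.integrable_bound[OF tilt_integrable[OF i]])
  note [measurable] = score_measurable[OF S] tilt_measurable
  show "(\<lambda>w. tilt i w * of_bool (extreme S \<alpha> i w)) \<in> borel_measurable M"
    unfolding extreme_def of_bool_def using i by measurable
qed auto

definition miss :: "('x \<times> 'e \<times> 'y \<Rightarrow> real) \<Rightarrow> real \<Rightarrow> nat \<Rightarrow> 'w \<Rightarrow> bool" where
  "miss S \<alpha> i w \<longleftrightarrow>
     Y i True w \<notin> ia_wcp_set N MY \<pi> Nb S \<alpha> (Xv w) (Tv w) (Ev w) (unit_vec N (\<lambda>j. Y j True) w) i"

lemma miss_iff:
  assumes i: "i \<in> {1..N}" and w: "w \<in> space M"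
  shows "miss S \<alpha> i w \<longleftrightarrow>
    wt \<pi> (X i w) + (\<Sum>j\<in>{1..N}. tilt j w * of_bool (i \<in> Nb j (Xv w) \<or> score S i w \<le> score S j w))
      \<le> \<alpha> * (wt \<pi> (X i w) + (\<Sum>j\<in>{1..N}. tilt j w))"
proof -
  have y: "Y i True w \<in> space MY"
    using Y_measurable[OF i] w by (auto dest: measurable_space)
  have pos: "0 < wt \<pi> (Xv w j)" if "j \<in> {1..N}" for j
    using \<pi>_range[OF X_space[OF that w]] that by (simp add: wt_pos)
  have 1: "(\<Sum>j\<in>treated N (Tv w). wt \<pi> (Xv w j) * of_bool (i \<in> Nb j (Xv w) \<or>
        S (Xv w i, Ev w i, Y i True w) \<le> S (Xv w j, Ev w j, unit_vec N (\<lambda>j. Y j True) w j))) =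
      (\<Sum>j\<in>{1..N}. tilt j w * of_bool (i \<in> Nb j (Xv w) \<or> score S i w \<le> score S j w))"
    unfolding sum_treated using i by (intro sum.cong) (auto simp: tilt_def score_def)
  have 2: "(\<Sum>j\<in>treated N (Tv w). wt \<pi> (Xv w j)) = (\<Sum>j\<in>{1..N}. tilt j w)"
    unfolding sum_treated by (intro sum.cong) (auto simp: tilt_def)
  have 3: "wt \<pi> (Xv w i) = wt \<pi> (X i w)"
    using i by simp
  show ?thesis
    unfolding miss_def 1[symmetric] 2[symmetric] 3[symmetric]
    by (rule not_in_ia_wcp_set_iff[OF pos i y])
qed

text \<open>The event is cut into finitely many cells, one for each treatment vector and each set of
  units having \<open>i\<close> as a neighbor. On a cell, \<open>flip_integral\<close> applies; the
  cells are then reassembled under the flipped densities.\<close>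

lemma prob_miss_le:
  assumes S: "S \<in> borel_measurable (MX \<Otimes>\<^sub>M ME \<Otimes>\<^sub>M MY)" and i: "i \<in> {1..N}"
    and ev: "{w\<in>space M. miss S \<alpha> i w \<and> \<not> T i w} \<in> events"
  shows "prob {w\<in>space M. miss S \<alpha> i w \<and> \<not> T i w} \<le> (\<integral>w. tilt i w * of_bool (extreme S \<alpha> i w) \<partial>M)"
proof -
  \<comment> \<open>Splitting by the set \<open>K\<close> of units that have \<open>i\<close> as a neighbor makes the index set of the
    unaffected units deterministic.\<close>
  define D where "D K = {x \<in> space SX. \<forall>j\<in>{1..N}. i \<in> Nb j x \<longleftrightarrow> j \<in> K}" for K
  \<comment> \<open>A unit is not its own neighbor, so \<open>K\<close> omits \<open>i\<close>. This
    keeps the exposure and outcome of \<open>i\<close> itself among the data that the flip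
    preserves.\<close>
  define P where "P = {t \<in> {1..N} \<rightarrow>\<^sub>E UNIV. \<not> t i} \<times> Pow ({1..N} - {i})"
  define Q where "Q K w = ((Xv w, \<lambda>j\<in>{1..N} - K. E j w), \<lambda>j\<in>{1..N} - K. Y j True w)" for K w
  define MQ where "MQ K = (SX \<Otimes>\<^sub>M PiM ({1..N} - K) (\<lambda>_. ME)) \<Otimes>\<^sub>M PiM ({1..N} - K) (\<lambda>_. MY)" for K :: "nat set"
  define sc where "sc z j = S (fst (fst z) j, snd (fst z) j, snd z j)" for z :: "((nat \<Rightarrow> 'x) \<times> (nat \<Rightarrow> 'e)) \<times> (nat \<Rightarrow> 'y)" and j
  \<comment> \<open>The miss criterion with \<open>t\<close> and \<open>K\<close> frozen. Units in
    \<open>K\<close> count fully whatever their score, so only data recorded by \<open>Q\<close>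
    enter.\<close>
  define F where "F t K = {z \<in> space (MQ K).
     wt \<pi> (fst (fst z) i) + (\<Sum>j\<in>treated N t \<inter> K. wt \<pi> (fst (fst z) j))
       + (\<Sum>j\<in>treated N t - K. wt \<pi> (fst (fst z) j) * of_bool (sc z i \<le> sc z j))
     \<le> \<alpha> * (wt \<pi> (fst (fst z) i) + (\<Sum>j\<in>treated N t. wt \<pi> (fst (fst z) j)))}" for t K
  define Kw where "Kw w = {j\<in>{1..N}. i \<in> Nb j (Xv w)}" for w
  have finP: "finite P"
    unfolding P_def by (intro finite_cartesian_product finite_subset[OF _ finite_PiE[of "{1..N}" "\<lambda>_. UNIV"]]) auto
  have finT: "finite (treated N t)" for t
    by (simp add: treated_def)
  have D: "D K \<in> sets SX" for K
  proof -
    have [measurable]: "Measurable.pred SX (\<lambda>x. i \<in> Nb j x)" if "j \<in> {1..N}" for j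
      using Nb_measurable[OF that i] by (simp add: pred_def)
    show ?thesis
      unfolding D_def by measurable
  qed
  have F: "F t K \<in> sets (MQ K)" if K: "i \<notin> K" for t K
  proof -
    have X: "(\<lambda>z. wt \<pi> (fst (fst z) j)) \<in> borel_measurable (MQ K)" if "j \<in> {1..N}" for j
      unfolding MQ_def using that
      by (intro measurable_compose[OF _ wt_measurable]) measurable
    have sc: "(\<lambda>z. sc z j) \<in> borel_measurable (MQ K)" if "j \<in> {1..N} - K" for j
      unfolding sc_def MQ_def using that
      by (intro measurable_compose[OF _ S] measurable_Pair) measurable
    have le: "(\<lambda>z. of_bool (sc z i \<le> sc z j) :: real) \<in> borel_measurable (MQ K)" if "j \<in> {1..N} - K" for j
    proof -
      note [measurable] = sc[of i] sc[OF that]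
      have "i \<in> {1..N} - K"
        using i K by simp
      then show ?thesis
        unfolding of_bool_def by measurable
    qed
    show ?thesis
      unfolding F_def
      by (intro borel_measurable_le borel_measurable_add borel_measurable_sum borel_measurable_times
          borel_measurable_const X le i) (auto simp: treated_def)
  qed
  have Q: "Q K w \<in> space (MQ K)" if "w \<in> space M" for K w
  proof (rule measurable_space[OF _ that])
    show "Q K \<in> M \<rightarrow>\<^sub>M MQ K"
      unfolding Q_def MQ_def
      by (intro measurable_Pair Xv_measurable measurable_restrict E_measurable Y_measurable) auto
  qed
  have Kw: "Kw w \<in> Pow ({1..N} - {i})" if "w \<in> space M" for w
    using Nb_subset[OF i measurable_space[OF Xv_measurable that]] by (auto simp: Kw_def)
  \<comment> \<open>\<open>K\<close> must be the realized set, but \<open>t\<close> stays free: it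
    will be the realized treatment vector before the flip, and that vector with \<open>i\<close>
    reset to untreated after it.\<close>
  have FQ: "Q K w \<in> F t K \<longleftrightarrow>
      wt \<pi> (X i w) + (\<Sum>j\<in>treated N t. wt \<pi> (X j w) * of_bool (i \<in> Nb j (Xv w) \<or> score S i w \<le> score S j w))
       \<le> \<alpha> * (wt \<pi> (X i w) + (\<Sum>j\<in>treated N t. wt \<pi> (X j w)))"
    if w: "w \<in> space M" and K: "K = Kw w" for t K w
  proof -
    have iK: "i \<in> {1..N} - K"
      using Kw[OF w] i K by auto
    have sc: "sc (Q K w) j = score S j w" if "j \<in> {1..N} - K" for j
      using that by (simp add: sc_def Q_def score_def)
    have X: "fst (fst (Q K w)) j = X j w" if "j \<in> {1..N}" for j
      using that by (simp add: Q_def)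
    have "(\<Sum>j\<in>treated N t. wt \<pi> (X j w) * of_bool (i \<in> Nb j (Xv w) \<or> score S i w \<le> score S j w)) =
       (\<Sum>j\<in>treated N t \<inter> K. wt \<pi> (X j w) * of_bool (i \<in> Nb j (Xv w) \<or> score S i w \<le> score S j w)) +
       (\<Sum>j\<in>treated N t - K. wt \<pi> (X j w) * of_bool (i \<in> Nb j (Xv w) \<or> score S i w \<le> score S j w))"
      by (rule sum.Int_Diff[OF finT])
    also have "(\<Sum>j\<in>treated N t \<inter> K. wt \<pi> (X j w) * of_bool (i \<in> Nb j (Xv w) \<or> score S i w \<le> score S j w)) =
       (\<Sum>j\<in>treated N t \<inter> K. wt \<pi> (fst (fst (Q K w)) j))"
      using X by (intro sum.cong) (auto simp: K Kw_def treated_def)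
    also have "(\<Sum>j\<in>treated N t - K. wt \<pi> (X j w) * of_bool (i \<in> Nb j (Xv w) \<or> score S i w \<le> score S j w)) =
       (\<Sum>j\<in>treated N t - K. wt \<pi> (fst (fst (Q K w)) j) * of_bool (sc (Q K w) i \<le> sc (Q K w) j))"
      using X sc[OF iK] sc by (intro sum.cong) (auto simp: K Kw_def treated_def)
    finally have 1: "wt \<pi> (X i w) + (\<Sum>j\<in>treated N t. wt \<pi> (X j w) * of_bool (i \<in> Nb j (Xv w) \<or> score S i w \<le> score S j w)) =
       wt \<pi> (fst (fst (Q K w)) i) + (\<Sum>j\<in>treated N t \<inter> K. wt \<pi> (fst (fst (Q K w)) j))
       + (\<Sum>j\<in>treated N t - K. wt \<pi> (fst (fst (Q K w)) j) * of_bool (sc (Q K w) i \<le> sc (Q K w) j))"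
      by (simp only: X[OF i] add.assoc)
    have 2: "(\<Sum>j\<in>treated N t. wt \<pi> (X j w)) = (\<Sum>j\<in>treated N t. wt \<pi> (fst (fst (Q K w)) j))"
      using X by (intro sum.cong) (auto simp: treated_def)
    show ?thesis
      unfolding 1 2 F_def using Q[OF w] X[OF i] by simp
  qed
  let ?u = "\<lambda>p w. treat_density (D (snd p)) (fst p) (Xv w) (Tv w) * indicator (F (fst p) (snd p)) (Q (snd p) w)"
  let ?v = "\<lambda>p w. flip_density i (D (snd p)) (fst p) (Xv w) (Tv w) * indicator (F (fst p) (snd p)) (Q (snd p) w)"
  have flip: "(\<integral>w. ?u p w \<partial>M) = (\<integral>w. ?v p w \<partial>M)" "integrable M (?u p)" "integrable M (?v p)"
    if "p \<in> P" for p
  proof -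
    have "\<not> fst p i" "i \<notin> snd p"
      using that by (auto simp: P_def)
    moreover have "\<forall>x\<in>D (snd p). \<forall>j\<in>{1..N} - snd p. i \<notin> Nb j x"
      by (auto simp: D_def)
    ultimately show "(\<integral>w. ?u p w \<partial>M) = (\<integral>w. ?v p w \<partial>M)" "integrable M (?u p)" "integrable M (?v p)"
      unfolding Q_def using flip_integral[where i = i and t = "fst p" and J = "{1..N} - snd p", OF i _ D _ _ F[unfolded MQ_def]] by auto
  qed
  have XD: "Xv w \<in> D (Kw w)" if "w \<in> space M" for w
    using measurable_space[OF Xv_measurable that] by (auto simp: D_def Kw_def)
  have upper: "indicator {w\<in>space M. miss S \<alpha> i w \<and> \<not> T i w} w \<le> (\<Sum>p\<in>P. ?u p w)" if w: "w \<in> space M" for w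
  proof (cases "miss S \<alpha> i w \<and> \<not> T i w")
    case True
    \<comment> \<open>The cell containing \<open>w\<close>: its term alone already equals 1.\<close>
    define p where "p = (Tv w, Kw w)"
    have p: "p \<in> P"
      using True i Kw[OF w] by (auto simp: p_def P_def)
    have tr: "(\<Sum>j\<in>treated N (Tv w). wt \<pi> (X j w) * f j) = (\<Sum>j\<in>{1..N}. tilt j w * f j)" for f
      unfolding sum_treated by (intro sum.cong) (auto simp: tilt_def)
    have "Q (Kw w) w \<in> F (Tv w) (Kw w)"
      unfolding FQ[OF w refl] tr tr[of "\<lambda>_. 1", unfolded mult_1_right] using miss_iff[OF i w] True by blast
    then have "?u p w = 1"
      using XD[OF w] by (simp add: p_def treat_density_def)
    moreover have "?u p w \<le> (\<Sum>p\<in>P. ?u p w)"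
      using finP p by (intro member_le_sum) (auto simp: treat_density_bounds)
    ultimately show ?thesis
      by (simp add: indicator_def)
  next
    case False
    then show ?thesis
      by (auto simp: treat_density_bounds intro!: sum_nonneg mult_nonneg_nonneg)
  qed
  have lower: "(\<Sum>p\<in>P. ?v p w) \<le> tilt i w * of_bool (extreme S \<alpha> i w)" if w: "w \<in> space M" for w
  proof -
    \<comment> \<open>Undoing the flip at \<open>w\<close> gives the only cell whose flipped density
      can be nonzero there.\<close>
    define p where "p = ((Tv w)(i := False), Kw w)"
    have uniq: "q = p" "T i w" if q: "q \<in> P" and nz: "flip_density i (D (snd q)) (fst q) (Xv w) (Tv w) \<noteq> 0" for q
    proof -
      obtain t K where q': "q = (t, K)"
        by (cases q)
      from nz have "Xv w \<in> D K" and T: "\<forall>j\<in>{1..N}. T j w = (t(i := True)) j"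
        by (auto simp: q' flip_density_def treat_density_def indicator_def split: if_splits)
      then have "K = Kw w"
        using q by (auto simp: q' D_def Kw_def P_def)
      \<comment> \<open>Inside \<open>{1..N}\<close> the flipped vector determines \<open>t\<close>
        except at \<open>i\<close>, where \<open>P\<close> prescribes \<open>False\<close>; outside,
        both functions are extensional.\<close>
      moreover have "t = (Tv w)(i := False)"
      proof
        fix j
        show "t j = ((Tv w)(i := False)) j"
          using q T i by (cases "j \<in> {1..N}") (auto simp: q' P_def PiE_def extensional_def)
      qed
      ultimately show "q = p"
        by (simp add: q' p_def)
      show "T i w"
        using T i by auto
    qed
    have wi: "0 < wt \<pi> (X i w)"
      using \<pi>_range[OF X_space[OF i w]] by (simp add: wt_pos)
    have p: "p \<in> P"
      using Kw[OF w] i by (auto simp: p_def P_def PiE_def extensional_def)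
    have zero: "?v q w = 0" if "q \<in> P - {p}" for q
      using uniq(1)[of q] that by (cases "flip_density i (D (snd q)) (fst q) (Xv w) (Tv w) = 0") simp_all
    have "(\<Sum>q\<in>P. ?v q w) = (\<Sum>q\<in>{p}. ?v q w)"
    proof (rule sum.mono_neutral_right[OF finP])
      show "{p} \<subseteq> P"
        using p by simp
      show "\<forall>q\<in>P - {p}. ?v q w = 0"
        using zero by (rule ballI)
    qed
    also have "\<dots> = ?v p w"
      by (simp only: sum.insert finite.emptyI empty_iff not_False_eq_True sum.empty add_0_right)
    also have "\<dots> \<le> tilt i w * of_bool (extreme S \<alpha> i w)"
    proof (cases "?v p w = 0")
      case True
      show ?thesis
        unfolding True using tilt_nonneg[OF i w] by simp
    next
      case False
      then have Ti: "T i w" and QF: "Q (Kw w) w \<in> F ((Tv w)(i := False)) (Kw w)"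
        using uniq(2)[OF p] by (auto simp: p_def indicator_def split: if_splits)
      have vp: "?v p w \<le> tilt i w"
        using Ti wi i by (auto simp: flip_density_def treat_density_def tilt_def indicator_def)
      \<comment> \<open>Once \<open>i\<close> is treated, the separate term of the test unit is just
        its own summand in the sum over treated units.\<close>
      have tr: "wt \<pi> (X i w) * f i + (\<Sum>j\<in>treated N ((Tv w)(i := False)). wt \<pi> (X j w) * f j) = (\<Sum>j\<in>{1..N}. tilt j w * f j)" for f
      proof -
        have "(\<Sum>j\<in>{1..N}. tilt j w * f j) = tilt i w * f i + (\<Sum>j\<in>{1..N} - {i}. tilt j w * f j)"
          using i by (simp add: sum.remove)
        also have "(\<Sum>j\<in>{1..N} - {i}. tilt j w * f j) = (\<Sum>j\<in>treated N ((Tv w)(i := False)). wt \<pi> (X j w) * f j)"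
          by (intro sum.mono_neutral_cong_right) (auto simp: treated_def tilt_def split: if_splits)
        finally show ?thesis
          using Ti by (simp add: tilt_def)
      qed
      have "(\<Sum>j\<in>{1..N}. tilt j w * of_bool (score S i w \<le> score S j w)) =
          wt \<pi> (X i w) + (\<Sum>j\<in>treated N ((Tv w)(i := False)). wt \<pi> (X j w) * of_bool (score S i w \<le> score S j w))"
        by (subst tr[symmetric]) simp
      \<comment> \<open>Granting full weight to the units that have \<open>i\<close> as a neighbor
        can only enlarge the tail sum, so the criterion in \<open>F\<close> is stronger than
        \<open>extreme\<close>.\<close>
      also have "\<dots> \<le> wt \<pi> (X i w) + (\<Sum>j\<in>treated N ((Tv w)(i := False)).
          wt \<pi> (X j w) * of_bool (i \<in> Nb j (Xv w) \<or> score S i w \<le> score S j w))"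
        using \<pi>_range[OF X_space[OF _ w]]
        by (intro add_left_mono sum_mono mult_left_mono) (auto simp: treated_def intro!: less_imp_le wt_pos)
      also have "\<dots> \<le> \<alpha> * (\<Sum>j\<in>{1..N}. tilt j w)"
        using QF unfolding FQ[OF w refl] using tr[of "\<lambda>_. 1"] by simp
      finally have "extreme S \<alpha> i w"
        by (simp add: extreme_def)
      then show ?thesis
        using vp by simp
    qed
    finally show ?thesis .
  qed
  have "prob {w\<in>space M. miss S \<alpha> i w \<and> \<not> T i w} = (\<integral>w. indicator {w\<in>space M. miss S \<alpha> i w \<and> \<not> T i w} w \<partial>M)"
    using ev by simp
  also have "\<dots> \<le> (\<integral>w. (\<Sum>p\<in>P. ?u p w) \<partial>M)"
    using ev upper flip(2)
    by (intro integral_mono Bochner_Integration.integrable_sum integrable_real_indicator) (auto simp: less_top[symmetric])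
  also have "\<dots> = (\<Sum>p\<in>P. \<integral>w. ?u p w \<partial>M)"
    using flip(2) by (rule Bochner_Integration.integral_sum)
  also have "\<dots> = (\<Sum>p\<in>P. \<integral>w. ?v p w \<partial>M)"
    using flip(1) by (rule sum.cong[OF refl])
  also have "\<dots> = (\<integral>w. (\<Sum>p\<in>P. ?v p w) \<partial>M)"
    using flip(3) by (rule Bochner_Integration.integral_sum[symmetric])
  also have "\<dots> \<le> (\<integral>w. tilt i w * of_bool (extreme S \<alpha> i w) \<partial>M)"
    using lower flip(3) tilt_extreme_integrable[OF S i]
    by (intro integral_mono Bochner_Integration.integrable_sum) auto
  finally show ?thesis .
qed

text \<open>The bound concerns the sum over \<open>i\<close>, not each probability separately: at
  every sample point the treated units share one \<alpha>-tail, and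
  \<open>weighted_quantile_bound\<close> applies there with the weights \<open>tilt\<close>.\<close>

lemma sum_prob_miss_le:
  assumes S: "S \<in> borel_measurable (MX \<Otimes>\<^sub>M ME \<Otimes>\<^sub>M MY)" and \<alpha>: "0 \<le> \<alpha>"
    and ev: "\<And>i. i \<in> {1..N} \<Longrightarrow> {w\<in>space M. miss S \<alpha> i w \<and> \<not> T i w} \<in> events"
  shows "(\<Sum>i\<in>{1..N}. prob {w\<in>space M. miss S \<alpha> i w \<and> \<not> T i w}) \<le> \<alpha> * (\<Sum>i\<in>{1..N}. prob {w\<in>space M. \<not> T i w})"
proof -
  have "(\<Sum>i\<in>{1..N}. prob {w\<in>space M. miss S \<alpha> i w \<and> \<not> T i w}) \<le>
      (\<Sum>i\<in>{1..N}. \<integral>w. tilt i w * of_bool (extreme S \<alpha> i w) \<partial>M)"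
    by (intro sum_mono prob_miss_le S ev)
  also have "\<dots> = (\<integral>w. (\<Sum>i\<in>{1..N}. tilt i w * of_bool (extreme S \<alpha> i w)) \<partial>M)"
    using tilt_extreme_integrable[OF S] by (rule Bochner_Integration.integral_sum[symmetric])
  also have "\<dots> \<le> (\<integral>w. \<alpha> * (\<Sum>i\<in>{1..N}. tilt i w) \<partial>M)"
    unfolding extreme_def
    by (intro integral_mono Bochner_Integration.integrable_sum integrable_mult_right weighted_quantile_bound
        tilt_extreme_integrable[OF S, unfolded extreme_def] tilt_integrable tilt_nonneg \<alpha>) auto
  also have "\<dots> = \<alpha> * (\<Sum>i\<in>{1..N}. \<integral>w. tilt i w \<partial>M)"
    unfolding integral_mult_right_zero
    by (intro arg_cong2[where f = "(*)"] Bochner_Integration.integral_sum tilt_integrable refl)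
  also have "\<dots> = \<alpha> * (\<Sum>i\<in>{1..N}. prob {w\<in>space M. \<not> T i w})"
    by (simp add: prob_untreated)
  finally show ?thesis .
qed

section \<open>The random test unit and the events determined by the joint data\<close>

abbreviation "joint_space \<equiv> SX \<Otimes>\<^sub>M ST \<Otimes>\<^sub>M SE \<Otimes>\<^sub>M unit_space N (MY \<Otimes>\<^sub>M MY)"
abbreviation "joint_vec w \<equiv> (Xv w, Tv w, Ev w, unit_vec N (\<lambda>i v. (Y i False v, Y i True v)) w)"

lemma joint_vec_measurable: "joint_vec \<in> M \<rightarrow>\<^sub>M joint_space"
  by (intro measurable_Pair measurable_restrict X_measurable T_measurable E_measurable Y_measurable)

lemma untreated_joint:
  assumes i: "i \<in> {1..N}"
  shows "\<exists>B\<in>sets joint_space. {w\<in>space M. \<not> T i w} = joint_vec -` B \<inter> space M"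
proof (rule bexI)
  have [measurable]: "(\<lambda>z. fst (snd z) i) \<in> joint_space \<rightarrow>\<^sub>M count_space UNIV"
    using i by measurable
  show "{z \<in> space joint_space. \<not> fst (snd z) i} \<in> sets joint_space"
    by measurable
  show "{w\<in>space M. \<not> T i w} = joint_vec -` {z \<in> space joint_space. \<not> fst (snd z) i} \<inter> space M"
    using measurable_space[OF joint_vec_measurable] i by auto
qed

text \<open>Independence of \<open>I\<close> is stated for the sigma-algebra generated by
  \<open>joint_vec\<close>, so the event has to be exhibited as a preimage under it.
  \<open>miss_iff\<close> allows this, expressing a miss through finitely many measurable functions
  of the coordinates.\<close>

lemma miss_joint:
  assumes S: "S \<in> borel_measurable (MX \<Otimes>\<^sub>M ME \<Otimes>\<^sub>M MY)" and i: "i \<in> {1..N}"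
  shows "\<exists>B\<in>sets joint_space. {w\<in>space M. miss S \<alpha> i w \<and> \<not> T i w} = joint_vec -` B \<inter> space M"
proof (rule bexI)
  define tl where "tl z j = (of_bool (fst (snd z) j) * wt \<pi> (fst z j) :: real)" for z :: "(nat \<Rightarrow> 'x) \<times> (nat \<Rightarrow> bool) \<times> (nat \<Rightarrow> 'e) \<times> (nat \<Rightarrow> 'y \<times> 'y)" and j
  define sc where "sc z j = S (fst z j, fst (snd (snd z)) j, snd (snd (snd (snd z)) j))" for z :: "(nat \<Rightarrow> 'x) \<times> (nat \<Rightarrow> bool) \<times> (nat \<Rightarrow> 'e) \<times> (nat \<Rightarrow> 'y \<times> 'y)" and j
  define crit where "crit z \<longleftrightarrow> wt \<pi> (fst z i) + (\<Sum>j\<in>{1..N}. tl z j * of_bool (i \<in> Nb j (fst z) \<or> sc z i \<le> sc z j))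
      \<le> \<alpha> * (wt \<pi> (fst z i) + (\<Sum>j\<in>{1..N}. tl z j))" for z
  let ?B = "{z \<in> space joint_space. crit z \<and> \<not> fst (snd z) i}"
  have [measurable]: "(\<lambda>z. fst (snd z) j) \<in> joint_space \<rightarrow>\<^sub>M count_space UNIV" if "j \<in> {1..N}" for j
    using that by measurable
  have [measurable]: "(\<lambda>z. wt \<pi> (fst z j)) \<in> borel_measurable joint_space" if "j \<in> {1..N}" for j
    by (rule measurable_compose[OF measurable_fst wt_coord_measurable[OF that]])
  have [measurable]: "(\<lambda>z. tl z j) \<in> borel_measurable joint_space" if "j \<in> {1..N}" for j
    unfolding tl_def of_bool_def using that by measurable
  have [measurable]: "(\<lambda>z. sc z j) \<in> borel_measurable joint_space" if "j \<in> {1..N}" for j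
    unfolding sc_def using that by (intro measurable_compose[OF _ S] measurable_Pair) measurable
  have [measurable]: "Measurable.pred joint_space (\<lambda>z. i \<in> Nb j (fst z))" if "j \<in> {1..N}" for j
    using Nb_measurable[OF that i] by (intro measurable_compose[OF measurable_fst]) (simp add: pred_def)
  have [measurable]: "Measurable.pred joint_space crit"
    unfolding crit_def of_bool_def using i by measurable
  show "?B \<in> sets joint_space"
    using i by measurable
  have "miss S \<alpha> i w \<longleftrightarrow> crit (joint_vec w)" if w: "w \<in> space M" for w
  proof -
    have 1: "tl (joint_vec w) j = tilt j w" "sc (joint_vec w) j = score S j w" if "j \<in> {1..N}" for j
      using that by (auto simp: tl_def tilt_def sc_def score_def)
    have 2: "(\<Sum>j\<in>{1..N}. tl (joint_vec w) j * of_bool (i \<in> Nb j (fst (joint_vec w)) \<or> sc (joint_vec w) i \<le> sc (joint_vec w) j)) =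
        (\<Sum>j\<in>{1..N}. tilt j w * of_bool (i \<in> Nb j (Xv w) \<or> score S i w \<le> score S j w))"
      by (rule sum.cong) (simp_all only: 1 1(2)[OF i] fst_conv)
    have 3: "(\<Sum>j\<in>{1..N}. tl (joint_vec w) j) = (\<Sum>j\<in>{1..N}. tilt j w)"
      by (rule sum.cong) (simp_all only: 1)
    show ?thesis
      unfolding miss_iff[OF i w] crit_def 2 3 using i by simp
  qed
  then show "{w\<in>space M. miss S \<alpha> i w \<and> \<not> T i w} = joint_vec -` ?B \<inter> space M"
    using measurable_space[OF joint_vec_measurable] i by auto
qed

text \<open>Cutting by the value of \<open>I\<close> leaves events with a deterministic index;
  independence and uniformity then give each of them the factor 1 / N.\<close>

lemma prob_random_index:
  assumes I: "I \<in> M \<rightarrow>\<^sub>M count_space {1..N}"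
    and unif: "distr M (count_space {1..N}) I = uniform_count_measure {1..N}"
    and ind: "indep_set (sets (vimage_algebra (space M) I (count_space {1..N})))
       (sets (vimage_algebra (space M) joint_vec joint_space))"
    and A: "\<And>i. i \<in> {1..N} \<Longrightarrow> \<exists>B\<in>sets joint_space. {w\<in>space M. R i w} = joint_vec -` B \<inter> space M"
  shows "prob {w\<in>space M. R (I w) w} = (\<Sum>i\<in>{1..N}. prob {w\<in>space M. R i w}) / N"
proof -
  let ?I = "\<lambda>i. I -` {i} \<inter> space M"
  have ev: "{w\<in>space M. R i w} \<in> events" if "i \<in> {1..N}" for i
    using A[OF that] joint_vec_measurable by (auto simp: measurable_sets)
  have evI: "?I i \<in> events" if "i \<in> {1..N}" for i
    using I that by (intro measurable_sets[OF I]) auto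
  have pI: "prob (?I i) = 1 / N" if "i \<in> {1..N}" for i
  proof -
    have "prob (?I i) = measure (distr M (count_space {1..N}) I) {i}"
      using I that by (simp add: measure_distr)
    also have "\<dots> = 1 / N"
      unfolding unif using that by (simp add: measure_uniform_count_measure)
    finally show ?thesis .
  qed
  have prod: "prob (?I i \<inter> {w\<in>space M. R i w}) = prob {w\<in>space M. R i w} / N" if i: "i \<in> {1..N}" for i
  proof -
    obtain B where B: "B \<in> sets joint_space" "{w\<in>space M. R i w} = joint_vec -` B \<inter> space M"
      using A[OF i] by auto
    have "prob (?I i \<inter> {w\<in>space M. R i w}) = prob (?I i) * prob {w\<in>space M. R i w}"
      using i B by (intro indep_setD[OF ind]) (auto intro: in_vimage_algebra)
    then show ?thesis
      by (simp add: pI[OF i])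
  qed
  have "{w\<in>space M. R (I w) w} = (\<Union>i\<in>{1..N}. ?I i \<inter> {w\<in>space M. R i w})"
    using measurable_space[OF I] by auto
  also have "prob \<dots> = (\<Sum>i\<in>{1..N}. prob (?I i \<inter> {w\<in>space M. R i w}))"
    using ev evI by (intro finite_measure_finite_Union) (auto simp: disjoint_family_on_def)
  also have "\<dots> = (\<Sum>i\<in>{1..N}. prob {w\<in>space M. R i w}) / N"
    unfolding sum_divide_distrib by (rule sum.cong[OF refl prod])
  finally show ?thesis .
qed

end

theorem theorem1:
  fixes M :: "'w measure" and MX :: "'x measure" and ME :: "'e measure" and MY :: "'y measure"
    and N :: nat and PX :: "'x measure" and \<pi> :: "'x \<Rightarrow> real"
    and Nb :: "nat \<Rightarrow> (nat \<Rightarrow> 'x) \<Rightarrow> nat set"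
    and PE :: "'x \<times> ('x \<times> bool) multiset \<Rightarrow> 'e measure"
    and PY :: "bool \<Rightarrow> 'x \<times> 'e \<Rightarrow> 'y measure"
    and X :: "nat \<Rightarrow> 'w \<Rightarrow> 'x" and T :: "nat \<Rightarrow> 'w \<Rightarrow> bool" and E :: "nat \<Rightarrow> 'w \<Rightarrow> 'e"
    and Y :: "nat \<Rightarrow> bool \<Rightarrow> 'w \<Rightarrow> 'y" and Yobs :: "nat \<Rightarrow> 'w \<Rightarrow> 'y"
    and S :: "'x \<times> 'e \<times> 'y \<Rightarrow> real" and I :: "'w \<Rightarrow> nat" and \<alpha> :: real
  assumes model: "networked_interference M MX ME MY N PX \<pi> Nb PE PY X T E Y Yobs"
    and S_measurable: "S \<in> borel_measurable (MX \<Otimes>\<^sub>M ME \<Otimes>\<^sub>M MY)"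
    and alpha: "0 < \<alpha>" "\<alpha> < 1"
    and I_measurable: "I \<in> M \<rightarrow>\<^sub>M count_space {1..N}"
    and I_uniform: "distr M (count_space {1..N}) I = uniform_count_measure {1..N}"
    and I_indep: "prob_space.indep_set M
      (sets (vimage_algebra (space M) I (count_space {1..N})))
      (sets (vimage_algebra (space M)
        (\<lambda>w. (unit_vec N X w, unit_vec N T w, unit_vec N E w,
              unit_vec N (\<lambda>i v. (Y i False v, Y i True v)) w))
        (unit_space N MX \<Otimes>\<^sub>M unit_space N (count_space UNIV) \<Otimes>\<^sub>M unit_space N ME \<Otimes>\<^sub>M
         unit_space N (MY \<Otimes>\<^sub>M MY))))"
  shows "\<P>(w in M.
      Y (I w) True w \<notin> ia_wcp_set N MY \<pi> Nb S \<alpha>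
        (unit_vec N X w) (unit_vec N T w) (unit_vec N E w) (unit_vec N (\<lambda>j. Y j True) w) (I w)
      \<bar> \<not> T (I w) w) \<le> \<alpha>"
proof -
  interpret networked_interference M MX ME MY N PX \<pi> Nb PE PY X T E Y Yobs
    by (rule model)
  note index = prob_random_index[OF I_measurable I_uniform I_indep]
  have ev: "{w\<in>space M. miss S \<alpha> i w \<and> \<not> T i w} \<in> events" if "i \<in> {1..N}" for i
    by (rule bexE[OF miss_joint[OF S_measurable that, of \<alpha>]]) (simp only: measurable_sets[OF joint_vec_measurable])
  have "prob {w\<in>space M. miss S \<alpha> (I w) w \<and> \<not> T (I w) w} =
      (\<Sum>i\<in>{1..N}. prob {w\<in>space M. miss S \<alpha> i w \<and> \<not> T i w}) / N"
    by (rule index[OF miss_joint[OF S_measurable]])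
  also have "\<dots> \<le> \<alpha> * (\<Sum>i\<in>{1..N}. prob {w\<in>space M. \<not> T i w}) / N"
    using alpha by (intro divide_right_mono sum_prob_miss_le S_measurable ev) auto
  also have "\<dots> = \<alpha> * prob {w\<in>space M. \<not> T (I w) w}"
    by (subst index[OF untreated_joint]) simp_all
  finally have "prob {w\<in>space M. miss S \<alpha> (I w) w \<and> \<not> T (I w) w} \<le> \<alpha> * prob {w\<in>space M. \<not> T (I w) w}" .
  \<comment> \<open>For a null conditioning event the quotient is 0 by the convention for division
    by zero, and that case is settled by 0 \<le> \<alpha>.\<close>
  then show ?thesis
    unfolding cond_prob_def miss_def[symmetric] using alpha
    by (cases "prob {w\<in>space M. \<not> T (I w) w} = 0") (auto simp: divide_le_eq measure_nonneg less_le)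
qed

end
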